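(* Let $x \in \mathbb{R}^d$ be an input vector and let $\gamma \in \mathbb{N}_+$ be the maximal number of bits needed to store any coefficient of the input. Then there is an algorithm that computes a vector $\hat x \in \arg\min_{x' \in \mathbb{R}^d : \mathrm{supp}(x') \in \mathbb{M}_{k,\Delta}} \|x - x'\|$ and runs in time $O(d(\gamma + \log k)\log d \log \Delta)$.
   Context: Notation: $[d] = \{1,\dots,d\}$, $\mathrm{supp}(\theta) = \{i : \theta_i \neq 0\}$, $\|\cdot\|$ is the $\ell_2$-norm, $k,\Delta$ are positive integers. For $\Omega \subseteq [d]$ let $\mathrm{sep}(\Omega) = \min_{i \neq j \in \Omega}|i-j|$, $\mathbb{M}_\Delta = \{\Omega \subseteq [d] : \mathrm{sep}(\Omega) \ge \Delta\}$ and $\mathbb{M}_{k,\Delta} = \{\Omega \in \mathbb{M}_\Delta : |\Omega| = k\}$.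
   Formalization: The argmin can be empty (e.g. x = 0, or no set in M_{k,Δ}), so x̂ is claimed to lie in it only when it is nonempty; x̂ is also optimal when supp(x') need only lie inside a set of M_{k,Δ}. log d and log Δ are read as at least 1; coefficients share a fixed-point format. *)

theory Defs
  imports "HOL-Analysis.L2_Norm" "HOL-Library.Extended_Nat"
begin

text \<open>
  Vectors in \<open>\<real>\<^sup>d\<close> are functions on \<open>nat\<close> of which only the coordinates \<open>1, \<dots>, d\<close> matter;
  \<open>d\<close> has to be an ordinary variable because one program must work for all dimensions.
\<close>

definition supp :: "nat \<Rightarrow> (nat \<Rightarrow> real) \<Rightarrow> nat set" where
  "supp d \<theta> = {i \<in> {1..d}. \<theta> i \<noteq> 0}"

definition l2_dist :: "nat \<Rightarrow> (nat \<Rightarrow> real) \<Rightarrow> (nat \<Rightarrow> real) \<Rightarrow> real" where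
  "l2_dist d x y = L2_set (\<lambda>i. x i - y i) {1..d}"

text \<open>The minimum over the empty set is \<open>\<infinity>\<close>, so sets with at most one element are separated.\<close>

definition sep :: "nat set \<Rightarrow> enat" where
  "sep \<Omega> = (INF (i, j) \<in> {(i, j). i \<in> \<Omega> \<and> j \<in> \<Omega> \<and> i \<noteq> j}. enat (nat \<bar>int i - int j\<bar>))"

definition sep_sets :: "nat \<Rightarrow> nat \<Rightarrow> nat set set" where
  "sep_sets d \<Delta> = {\<Omega>. \<Omega> \<subseteq> {1..d} \<and> sep \<Omega> \<ge> enat \<Delta>}"

definition sep_sets_card :: "nat \<Rightarrow> nat \<Rightarrow> nat \<Rightarrow> nat set set" where
  "sep_sets_card d k \<Delta> = {\<Omega> \<in> sep_sets d \<Delta>. card \<Omega> = k}"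


subsection \<open>Word RAM programs\<close>

text \<open>
  Algorithms are programs of a small imperative language with integer variables and integer
  arrays. Every operation has unit cost, but every value occurring in an evaluation must fit
  into a machine word of \<open>w\<close> bits (plus a sign); otherwise, or on a negative array index or a
  division by zero, the program is stuck. Without the word bound, unit-cost multiplication
  would make the model unrealistically powerful.
\<close>

type_synonym vname = string

datatype aexp =
    Const int
  | Var vname
  | Elem vname aexp
  | Add aexp aexp
  | Sub aexp aexp
  | Mul aexp aexp
  | Div aexp aexp

datatype bexp = Less aexp aexp | Neg bexp | And bexp bexp

datatype com =
    Skip
  | Assign vname aexp
  | Store vname aexp aexp
  | Seq com com
  | Cond bexp com com
  | While bexp com

record state =
  vars :: "vname \<Rightarrow> int"
  arrs :: "vname \<Rightarrow> nat \<Rightarrow> int"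

definition word :: "nat \<Rightarrow> int \<Rightarrow> int option" where
  "word w v = (if \<bar>v\<bar> < 2 ^ w then Some v else None)"

definition word_op :: "nat \<Rightarrow> (int \<Rightarrow> int \<Rightarrow> int) \<Rightarrow> int option \<Rightarrow> int option \<Rightarrow> int option" where
  "word_op w f u v = Option.bind u (\<lambda>a. Option.bind v (\<lambda>b. word w (f a b)))"

fun aval :: "nat \<Rightarrow> state \<Rightarrow> aexp \<Rightarrow> int option" where
  "aval w s (Const n) = word w n"
| "aval w s (Var x) = word w (vars s x)"
| "aval w s (Elem a e) =
     Option.bind (aval w s e) (\<lambda>i. if 0 \<le> i then word w (arrs s a (nat i)) else None)"
| "aval w s (Add e1 e2) = word_op w (+) (aval w s e1) (aval w s e2)"
| "aval w s (Sub e1 e2) = word_op w (-) (aval w s e1) (aval w s e2)"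
| "aval w s (Mul e1 e2) = word_op w (*) (aval w s e1) (aval w s e2)"
| "aval w s (Div e1 e2) =
     (if aval w s e2 = Some 0 then None else word_op w (div) (aval w s e1) (aval w s e2))"

fun bval :: "nat \<Rightarrow> state \<Rightarrow> bexp \<Rightarrow> bool option" where
  "bval w s (Less e1 e2) =
     Option.bind (aval w s e1) (\<lambda>a. Option.bind (aval w s e2) (\<lambda>b. Some (a < b)))"
| "bval w s (Neg b) = map_option Not (bval w s b)"
| "bval w s (And b1 b2) =
     Option.bind (bval w s b1) (\<lambda>p. Option.bind (bval w s b2) (\<lambda>q. Some (p \<and> q)))"

fun acost :: "aexp \<Rightarrow> nat" where
  "acost (Const n) = 1"
| "acost (Var x) = 1"
| "acost (Elem a e) = 1 + acost e"
| "acost (Add e1 e2) = 1 + acost e1 + acost e2"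
| "acost (Sub e1 e2) = 1 + acost e1 + acost e2"
| "acost (Mul e1 e2) = 1 + acost e1 + acost e2"
| "acost (Div e1 e2) = 1 + acost e1 + acost e2"

fun bcost :: "bexp \<Rightarrow> nat" where
  "bcost (Less e1 e2) = 1 + acost e1 + acost e2"
| "bcost (Neg b) = 1 + bcost b"
| "bcost (And b1 b2) = 1 + bcost b1 + bcost b2"

text \<open>
  \<open>exec w c s t s'\<close>: with word size \<open>w\<close>, program \<open>c\<close> started in \<open>s\<close> halts in \<open>s'\<close> after
  exactly \<open>t\<close> steps.
\<close>

inductive exec :: "nat \<Rightarrow> com \<Rightarrow> state \<Rightarrow> nat \<Rightarrow> state \<Rightarrow> bool" for w :: nat where
  Skip: "exec w Skip s 1 s"
| Assign: "aval w s e = Some v \<Longrightarrow>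
    exec w (Assign x e) s (1 + acost e) (s\<lparr>vars := (vars s)(x := v)\<rparr>)"
| Store: "aval w s e1 = Some i \<Longrightarrow> 0 \<le> i \<Longrightarrow> aval w s e2 = Some v \<Longrightarrow>
    exec w (Store a e1 e2) s (1 + acost e1 + acost e2)
      (s\<lparr>arrs := (arrs s)(a := (arrs s a)(nat i := v))\<rparr>)"
| Seq: "exec w c1 s t1 s1 \<Longrightarrow> exec w c2 s1 t2 s2 \<Longrightarrow> exec w (Seq c1 c2) s (t1 + t2) s2"
| CondTrue: "bval w s b = Some True \<Longrightarrow> exec w c1 s t s1 \<Longrightarrow>
    exec w (Cond b c1 c2) s (1 + bcost b + t) s1"
| CondFalse: "bval w s b = Some False \<Longrightarrow> exec w c2 s t s1 \<Longrightarrow>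
    exec w (Cond b c1 c2) s (1 + bcost b + t) s1"
| WhileFalse: "bval w s b = Some False \<Longrightarrow> exec w (While b c) s (1 + bcost b) s"
| WhileTrue: "bval w s b = Some True \<Longrightarrow> exec w c s t1 s1 \<Longrightarrow> exec w (While b c) s1 t2 s2 \<Longrightarrow>
    exec w (While b c) s (1 + bcost b + t1 + t2) s2"

inductive_cases exec_elims:
  "exec w Skip s t s'" "exec w (Assign x e) s t s'" "exec w (Store a e1 e2) s t s'"
  "exec w (Seq c1 c2) s t s'" "exec w (Cond b c1 c2) s t s'"
  "exec w (While b c) s t s'"

lemma exec_deterministic:
  "exec w c s t s' \<Longrightarrow> exec w c s u s'' \<Longrightarrow> t = u \<and> s' = s''"
proof (induction arbitrary: u s'' rule: exec.induct)
  case (Skip s)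
  then show ?case by (rule exec_elims(1)) simp
next
  case (Assign s e v x)
  from Assign.prems show ?case by (rule exec_elims(2)) (use Assign.hyps in simp)
next
  case (Store s e1 i e2 v a)
  from Store.prems show ?case by (rule exec_elims(3)) (use Store.hyps in simp)
next
  case (Seq c1 s t1 s1 c2 t2 s2)
  from Seq.prems obtain t1' s1' t2' where
    u: "u = t1' + t2'" and 1: "exec w c1 s t1' s1'" and 2: "exec w c2 s1' t2' s''"
    by (rule exec_elims(4))
  from Seq.IH(1)[OF 1] have eq: "t1 = t1'" "s1 = s1'" by simp_all
  from Seq.IH(2)[OF 2[folded eq(2)]] show ?case by (simp add: u eq(1))
next
  case (CondTrue s b c1 t s1 c2)
  from CondTrue.prems show ?case
    by (rule exec_elims(5)) (use CondTrue.hyps in \<open>auto dest: CondTrue.IH\<close>)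
next
  case (CondFalse s b c2 t s1 c1)
  from CondFalse.prems show ?case
    by (rule exec_elims(5)) (use CondFalse.hyps in \<open>auto dest: CondFalse.IH\<close>)
next
  case (WhileFalse s b c)
  from WhileFalse.prems show ?case by (rule exec_elims(6)) (use WhileFalse.hyps in simp_all)
next
  case (WhileTrue s b c t1 s1 t2 s2)
  from WhileTrue.prems obtain t1' s1' t2' where
    u: "u = 1 + bcost b + t1' + t2'" and
    1: "exec w c s t1' s1'" and 2: "exec w (While b c) s1' t2' s''"
    by (rule exec_elims(6)) (use WhileTrue.hyps in simp_all)
  from WhileTrue.IH(1)[OF 1] have eq: "t1 = t1'" "s1 = s1'" by simp_all
  from WhileTrue.IH(2)[OF 2[folded eq(2)]] show ?case by (simp add: u eq(1))
qed


subsection \<open>Input, output and resource bounds\<close>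

text \<open>
  Coefficients are stored in a common fixed-point format: the mantissa \<open>m i\<close> stands for
  \<open>m i \<cdot> 2\<^sup>e\<close>. The number of bits of a mantissa is its length in two's complement.
\<close>

definition decode :: "int \<Rightarrow> (nat \<Rightarrow> int) \<Rightarrow> nat \<Rightarrow> real" where
  "decode e m i = of_int (m i) * 2 powi e"

definition bits :: "int \<Rightarrow> nat" where
  "bits n = (LEAST b. 0 < b \<and> - (2 ^ (b - 1)) \<le> n \<and> n < 2 ^ (b - 1))"

definition max_bits :: "nat \<Rightarrow> (nat \<Rightarrow> int) \<Rightarrow> nat" where
  "max_bits d m = Max ((\<lambda>i. bits (m i)) ` {1..d})"

definition input_state :: "nat \<Rightarrow> nat \<Rightarrow> nat \<Rightarrow> (nat \<Rightarrow> int) \<Rightarrow> state" where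
  "input_state d k \<Delta> m = \<lparr>
     vars = (\<lambda>_. 0)(''d'' := int d, ''k'' := int k, ''Delta'' := int \<Delta>),
     arrs = (\<lambda>_ _. 0)(''x'' := (\<lambda>i. if i \<in> {1..d} then m i else 0)) \<rparr>"

definition output_array :: "state \<Rightarrow> nat \<Rightarrow> int" where
  "output_array s = arrs s ''xhat''"

text \<open>A word is a constant factor \<open>c\<close> longer than what is needed to store the input numbers.\<close>

definition word_size :: "nat \<Rightarrow> nat \<Rightarrow> nat \<Rightarrow> nat \<Rightarrow> nat \<Rightarrow> nat" where
  "word_size c d k \<Delta> \<gamma> = c * (\<gamma> + bits (int d) + bits (int k) + bits (int \<Delta>))"

text \<open>
  As usual in running times, a logarithmic factor is read as at least 1; otherwise the bound
  would be 0 for \<open>d = 1\<close> or \<open>\<Delta> = 1\<close>.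
\<close>

definition lg :: "nat \<Rightarrow> real" where
  "lg n = max 1 (log 2 (real n))"

end

theory Submission
  imports Defs
begin

text \<open>
  Give coordinate \<open>i\<close> the weight \<open>f i = 2 ((k + 1) m\<^sub>i\<^sup>2 + [m\<^sub>i \<noteq> 0])\<close>; a separated \<open>k\<close>-set of
  maximal weight solves both versions of the projection problem. Lagrangian relaxation replaces the
  constraint \<open>|\<Omega>| = k\<close> by a penalty \<open>\<mu>\<close> per element, and the relaxed problem is solved by a
  linear-time dynamic program. Two separated sets of sizes \<open>l \<le> n \<le> r\<close> can be cut and spliced into
  separated sets of sizes \<open>n\<close> and \<open>l + r - n\<close>, so the optimal value is concave in the size, and its
  slopes are even. Hence the size of an optimum is unique for odd \<open>\<mu>\<close>, and \<open>O(\<gamma> + log k)\<close> bisection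
  steps find an even \<open>\<mu>\<close> such that \<open>\<mu> + 1\<close> yields fewer than \<open>k\<close> elements and \<open>\<mu> - 1\<close> at least
  \<open>k\<close>. Both sets are then optimal for \<open>\<mu>\<close> as well, and splicing them gives an optimal set of size
  exactly \<open>k\<close>.
\<close>

section \<open>Timed execution\<close>

text \<open>Nonnegative penalties do not suffice: heavy elements may block so many others that the
  set of maximal weight has fewer than \<open>k\<close> elements. The multiplier must therefore also
  be negative, down to about \<open>- M * k\<close> for weights bounded by \<open>M\<close>. The
  search interval then has length about \<open>M * (k + 1)\<close>, whose logarithm is the number of
  bisection steps. Ties are the obstacle to bisection: where the slope of the concave size profile
  equals \<mu>, several sizes are optimal and the dynamic program returns only one of them. Doubling
  the weights moves all ties to even multipliers and leaves the odd ones as unambiguous test points.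
  The size \<open>k\<close> itself may be optimal only at such a tie, so no single run needs to
  produce it; this is why two runs on either side of the tie are spliced. The two versions of the
  problem ask for a support equal to, or contained in, a separated \<open>k\<close>-set. In the
  first the infimum need not be attained, because a zero coefficient inside the set has to be
  replaced by an arbitrarily small nonzero one. Every intermediate value must fit into a word, so
  each correctness statement is accompanied by size estimates.\<close>

definition runs :: "nat \<Rightarrow> com \<Rightarrow> state \<Rightarrow> nat \<Rightarrow> (state \<Rightarrow> bool) \<Rightarrow> bool" where
  "runs w c s T Q \<longleftrightarrow> (\<exists>t s'. exec w c s t s' \<and> t \<le> T \<and> Q s')"

lemma runsI: "exec w c s t s' \<Longrightarrow> t \<le> T \<Longrightarrow> Q s' \<Longrightarrow> runs w c s T Q"
  unfolding runs_def by blast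

fun wvars :: "com \<Rightarrow> vname set" where
  "wvars Skip = {}"
| "wvars (Assign x e) = {x}"
| "wvars (Store a e1 e2) = {}"
| "wvars (Seq c1 c2) = wvars c1 \<union> wvars c2"
| "wvars (Cond b c1 c2) = wvars c1 \<union> wvars c2"
| "wvars (While b c) = wvars c"

fun warrs :: "com \<Rightarrow> vname set" where
  "warrs Skip = {}"
| "warrs (Assign x e) = {}"
| "warrs (Store a e1 e2) = {a}"
| "warrs (Seq c1 c2) = warrs c1 \<union> warrs c2"
| "warrs (Cond b c1 c2) = warrs c1 \<union> warrs c2"
| "warrs (While b c) = warrs c"

definition agree :: "com \<Rightarrow> state \<Rightarrow> state \<Rightarrow> bool" where
  "agree c s s' \<longleftrightarrow> (\<forall>v. v \<notin> wvars c \<longrightarrow> vars s' v = vars s v) \<and>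
     (\<forall>a. a \<notin> warrs c \<longrightarrow> arrs s' a = arrs s a)"

lemma exec_agree: "exec w c s t s' \<Longrightarrow> agree c s s'"
  by (induction rule: exec.induct) (auto simp: agree_def)

text \<open>Consequence rule with the frame rule built in: the new postcondition may use that
  everything outside the syntactic write sets is unchanged, so a specification mentions only what
  the command computes.\<close>

lemma runs_weaken:
  "runs w c s T Q \<Longrightarrow> T \<le> T' \<Longrightarrow> (\<And>s'. Q s' \<Longrightarrow> agree c s s' \<Longrightarrow> Q' s') \<Longrightarrow> runs w c s T' Q'"
  unfolding runs_def using exec_agree order_trans by blast

lemma runs_Seq:
  "runs w c1 s T1 (\<lambda>s'. runs w c2 s' T2 Q) \<Longrightarrow> runs w (Seq c1 c2) s (T1 + T2) Q"
  unfolding runs_def by (blast intro: exec.Seq add_mono)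

lemma runs_Seq_mid:
  assumes "runs w c1 s T1 R"
    and "\<And>s'. R s' \<Longrightarrow> agree c1 s s' \<Longrightarrow> runs w c2 s' T2 Q"
  shows "runs w (Seq c1 c2) s (T1 + T2) Q"
  by (rule runs_Seq, rule runs_weaken[OF assms(1)]) (use assms(2) in auto)

lemma runs_Cond:
  assumes "bval w s b = Some v" "v \<Longrightarrow> runs w c1 s T Q" "\<not> v \<Longrightarrow> runs w c2 s T Q"
  shows "runs w (Cond b c1 c2) s (1 + bcost b + T) Q"
proof (cases v)
  case True
  with assms show ?thesis by (force simp: runs_def intro: exec.CondTrue)
next
  case False
  with assms show ?thesis by (force simp: runs_def intro: exec.CondFalse)
qed

section \<open>Safe evaluation and loop rules\<close>

fun pval :: "state \<Rightarrow> aexp \<Rightarrow> int" where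
  "pval s (Const n) = n"
| "pval s (Var x) = vars s x"
| "pval s (Elem a e) = arrs s a (nat (pval s e))"
| "pval s (Add e1 e2) = pval s e1 + pval s e2"
| "pval s (Sub e1 e2) = pval s e1 - pval s e2"
| "pval s (Mul e1 e2) = pval s e1 * pval s e2"
| "pval s (Div e1 e2) = pval s e1 div pval s e2"

definition fits :: "nat \<Rightarrow> int \<Rightarrow> bool" where
  "fits w v \<longleftrightarrow> \<bar>v\<bar> < 2 ^ w"

text \<open>\<open>aval\<close> is partial at every node. Separating the total value
  \<open>pval\<close> from the side conditions turns an expression into a list of word bounds that
  the simplifier can discharge.\<close>

fun safe :: "nat \<Rightarrow> state \<Rightarrow> aexp \<Rightarrow> bool" where
  "safe w s (Const n) = fits w n"
| "safe w s (Var x) = fits w (vars s x)"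
| "safe w s (Elem a e) = (safe w s e \<and> 0 \<le> pval s e \<and> fits w (pval s (Elem a e)))"
| "safe w s (Add e1 e2) = (safe w s e1 \<and> safe w s e2 \<and> fits w (pval s (Add e1 e2)))"
| "safe w s (Sub e1 e2) = (safe w s e1 \<and> safe w s e2 \<and> fits w (pval s (Sub e1 e2)))"
| "safe w s (Mul e1 e2) = (safe w s e1 \<and> safe w s e2 \<and> fits w (pval s (Mul e1 e2)))"
| "safe w s (Div e1 e2) =
     (safe w s e1 \<and> safe w s e2 \<and> pval s e2 \<noteq> 0 \<and> fits w (pval s (Div e1 e2)))"

lemma aval_safe: "safe w s e \<Longrightarrow> aval w s e = Some (pval s e)"
  by (induction e) (auto simp: word_op_def word_def fits_def)

fun pbval :: "state \<Rightarrow> bexp \<Rightarrow> bool" where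
  "pbval s (Less e1 e2) \<longleftrightarrow> pval s e1 < pval s e2"
| "pbval s (Neg b) \<longleftrightarrow> \<not> pbval s b"
| "pbval s (And b1 b2) \<longleftrightarrow> pbval s b1 \<and> pbval s b2"

fun bsafe :: "nat \<Rightarrow> state \<Rightarrow> bexp \<Rightarrow> bool" where
  "bsafe w s (Less e1 e2) \<longleftrightarrow> safe w s e1 \<and> safe w s e2"
| "bsafe w s (Neg b) \<longleftrightarrow> bsafe w s b"
| "bsafe w s (And b1 b2) \<longleftrightarrow> bsafe w s b1 \<and> bsafe w s b2"

lemma bval_bsafe: "bsafe w s b \<Longrightarrow> bval w s b = Some (pbval s b)"
  by (induction b) (auto simp: aval_safe)

text \<open>The index of \<open>I\<close> is fuel: a bound on the remaining iterations, not their
  exact number. A true test without fuel is excluded by \<open>step\<close>. Agreement with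
  \<open>s0\<close> is available in every round, so invariants can omit whatever the body leaves
  alone.\<close>

lemma runs_While:
  assumes "I N s0"
    and step: "\<And>n s. I n s \<Longrightarrow> agree c s0 s \<Longrightarrow>
      bsafe w s b \<and> (\<not> pbval s b \<longrightarrow> Q s) \<and>
        (pbval s b \<longrightarrow> (\<exists>n'. n = Suc n' \<and> runs w c s T (I n')))"
  shows "runs w (While b c) s0 (N * (1 + bcost b + T) + (1 + bcost b)) Q"
proof -
  have "runs w (While b c) s (n * (1 + bcost b + T) + (1 + bcost b)) Q"
    if "I n s" "agree c s0 s" for n s
    using that
  proof (induction n arbitrary: s)
    case 0
    with step[of 0 s] show ?case by (auto intro: runsI[OF exec.WhileFalse] simp: bval_bsafe)
  next
    case (Suc n)
    from step[OF Suc.prems] have v: "bval w s b = Some (pbval s b)"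
      "\<not> pbval s b \<longrightarrow> Q s" "pbval s b \<longrightarrow> runs w c s T (I n)" by (auto simp: bval_bsafe)
    show ?case
    proof (cases "pbval s b")
      case False
      with v show ?thesis by (auto intro: runsI[OF exec.WhileFalse])
    next
      case True
      with v obtain t1 s1 where 1: "exec w c s t1 s1" "t1 \<le> T" "I n s1" by (auto simp: runs_def)
      have "agree c s0 s1" using exec_agree[OF 1(1)] Suc.prems(2) by (auto simp: agree_def)
      from Suc.IH[OF 1(3) this] obtain t2 s2 where
        2: "exec w (While b c) s1 t2 s2" "t2 \<le> n * (1 + bcost b + T) + (1 + bcost b)" "Q s2"
        by (auto simp: runs_def)
      have "exec w (While b c) s (1 + bcost b + t1 + t2) s2"
        using v(1) True 1(1) 2(1) by (intro exec.WhileTrue) auto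
      moreover have "1 + bcost b + t1 + t2 \<le> Suc n * (1 + bcost b + T) + (1 + bcost b)"
        using 1 2 by simp
      ultimately show ?thesis using 2(3) by (rule runsI)
    qed
  qed
  then show ?thesis using assms(1) by (simp add: agree_def)
qed

text \<open>For loop-free commands; the values on loops are irrelevant.\<close>

fun wp :: "nat \<Rightarrow> com \<Rightarrow> (state \<Rightarrow> bool) \<Rightarrow> state \<Rightarrow> bool" where
  "wp w Skip Q s = Q s"
| "wp w (Assign x e) Q s = (safe w s e \<and> Q (s\<lparr>vars := (vars s)(x := pval s e)\<rparr>))"
| "wp w (Store a e1 e2) Q s = (safe w s e1 \<and> 0 \<le> pval s e1 \<and> safe w s e2 \<and>
     Q (s\<lparr>arrs := (arrs s)(a := (arrs s a)(nat (pval s e1) := pval s e2))\<rparr>))"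
| "wp w (Seq c1 c2) Q s = wp w c1 (wp w c2 Q) s"
| "wp w (Cond b c1 c2) Q s =
     (bsafe w s b \<and> (pbval s b \<longrightarrow> wp w c1 Q s) \<and> (\<not> pbval s b \<longrightarrow> wp w c2 Q s))"
| "wp w (While b c) Q s = False"

fun max_cost :: "com \<Rightarrow> nat" where
  "max_cost Skip = 1"
| "max_cost (Assign x e) = 1 + acost e"
| "max_cost (Store a e1 e2) = 1 + acost e1 + acost e2"
| "max_cost (Seq c1 c2) = max_cost c1 + max_cost c2"
| "max_cost (Cond b c1 c2) = 1 + bcost b + max (max_cost c1) (max_cost c2)"
| "max_cost (While b c) = 0"

lemma runs_wp: "wp w c Q s \<Longrightarrow> runs w c s (max_cost c) Q"
proof (induction c arbitrary: Q s)
  case Skip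
  then show ?case by (auto intro: runsI[OF exec.Skip])
next
  case (Assign x e)
  then show ?case by (auto intro: runsI[OF exec.Assign[OF aval_safe]])
next
  case (Store a e1 e2)
  then show ?case by (auto intro: runsI[OF exec.Store[OF aval_safe _ aval_safe]])
next
  case (Seq c1 c2)
  have "runs w c1 s (max_cost c1) (wp w c2 Q)" using Seq by simp
  then have "runs w (Seq c1 c2) s (max_cost c1 + max_cost c2) Q"
    by (rule runs_Seq_mid) (rule Seq.IH)
  then show ?case by simp
next
  case (Cond b c1 c2)
  then have v: "bval w s b = Some (pbval s b)"
    "pbval s b \<longrightarrow> wp w c1 Q s" "\<not> pbval s b \<longrightarrow> wp w c2 Q s" by (auto simp: bval_bsafe)
  have "runs w (Cond b c1 c2) s (1 + bcost b + max (max_cost c1) (max_cost c2)) Q"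
  proof (rule runs_Cond[OF v(1)])
    assume "pbval s b"
    with v have "runs w c1 s (max_cost c1) Q" by (intro Cond.IH) simp
    then show "runs w c1 s (max (max_cost c1) (max_cost c2)) Q" by (rule runs_weaken) simp_all
  next
    assume "\<not> pbval s b"
    with v have "runs w c2 s (max_cost c2) Q" by (intro Cond.IH) simp
    then show "runs w c2 s (max (max_cost c1) (max_cost c2)) Q" by (rule runs_weaken) simp_all
  qed
  then show ?case by simp
qed simp

section \<open>Lagrangian relaxation of separated sets\<close>

text \<open>Lists represent separated sets in decreasing order, the order in which backtracking
  through the dynamic program meets the elements. \<open>sorted_wrt\<close> relates all pairs, so
  for \<Delta> \<ge> 1 the entries are distinct.\<close>

definition chain :: "nat \<Rightarrow> nat \<Rightarrow> nat list \<Rightarrow> bool" where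
  "chain \<Delta> d xs \<longleftrightarrow> sorted_wrt (\<lambda>a b. b + \<Delta> \<le> a) xs \<and> set xs \<subseteq> {1..d}"

definition lagrangian :: "(nat \<Rightarrow> int) \<Rightarrow> int \<Rightarrow> nat list \<Rightarrow> int" where
  "lagrangian f \<mu> xs = (\<Sum>x\<leftarrow>xs. f x) - \<mu> * int (length xs)"

definition optimal :: "nat \<Rightarrow> nat \<Rightarrow> (nat \<Rightarrow> int) \<Rightarrow> int \<Rightarrow> nat list \<Rightarrow> bool" where
  "optimal \<Delta> d f \<mu> xs \<longleftrightarrow>
     chain \<Delta> d xs \<and> (\<forall>ys. chain \<Delta> d ys \<longrightarrow> lagrangian f \<mu> ys \<le> lagrangian f \<mu> xs)"

lemma chain_Nil [simp]: "chain \<Delta> d []"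
  by (simp add: chain_def)

lemma chain_Cons:
  "chain \<Delta> d (x # xs) \<longleftrightarrow> 1 \<le> x \<and> x \<le> d \<and> (\<forall>y\<in>set xs. y + \<Delta> \<le> x) \<and> chain \<Delta> d xs"
  by (auto simp: chain_def)

lemma chain_mono: "chain \<Delta> d xs \<Longrightarrow> d \<le> d' \<Longrightarrow> chain \<Delta> d' xs"
  by (auto simp: chain_def)

lemma chain_nth_bounds: "chain \<Delta> d xs \<Longrightarrow> i < length xs \<Longrightarrow> 1 \<le> xs ! i \<and> xs ! i \<le> d"
  using nth_mem by (fastforce simp: chain_def)

lemma chain_nth_gap:
  "chain \<Delta> d xs \<Longrightarrow> i < j \<Longrightarrow> j < length xs \<Longrightarrow> xs ! j + \<Delta> \<le> xs ! i"
  by (auto simp: chain_def sorted_wrt_iff_nth_less)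

lemma chain_nth_mono:
  "chain \<Delta> d xs \<Longrightarrow> i \<le> j \<Longrightarrow> j < length xs \<Longrightarrow> xs ! j \<le> xs ! i"
  using chain_nth_gap[of \<Delta> d xs i j] by (cases "i = j") auto

lemma chain_distinct:
  assumes "chain \<Delta> d xs" "1 \<le> \<Delta>"
  shows "distinct xs"
  using assms(1)
proof (induction xs)
  case (Cons x xs)
  then show ?case using assms(2) by (force simp: chain_Cons)
qed simp

lemma chain_length:
  assumes "chain \<Delta> d xs" "1 \<le> \<Delta>"
  shows "length xs \<le> d"
proof -
  have "card (set xs) \<le> card {1..d}"
    using assms(1) by (intro card_mono) (auto simp: chain_def)
  with distinct_card[OF chain_distinct[OF assms]] show ?thesis by simp
qed

section \<open>Cutting and splicing two chains\<close>

lemma chain_take_append_drop: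
  assumes xs: "chain \<Delta> d xs" and ys: "chain \<Delta> d ys" and "i \<le> length xs"
    and link: "0 < i \<Longrightarrow> j < length ys \<Longrightarrow> ys ! j + \<Delta> \<le> xs ! (i - 1)"
  shows "chain \<Delta> d (take i xs @ drop j ys)"
proof -
  have "b + \<Delta> \<le> a" if "a \<in> set (take i xs)" "b \<in> set (drop j ys)" for a b
  proof -
    from that(1) assms(3) obtain p where p: "p < i" "a = xs ! p"
      by (auto simp: in_set_conv_nth)
    from that(2) obtain q where "q < length (drop j ys)" "b = drop j ys ! q"
      by (auto simp only: in_set_conv_nth)
    then have q: "j + q < length ys" "b = ys ! (j + q)" by auto
    \<comment> \<open>Only the seam matters: in decreasing lists \<open>xs ! (i - 1)\<close> is the
      smallest entry of the head and \<open>ys ! j\<close> the largest of the tail.\<close>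
    have "b \<le> ys ! j" using chain_nth_mono[OF ys, of j "j + q"] q by simp
    moreover have "xs ! (i - 1) \<le> a" using chain_nth_mono[OF xs, of p "i - 1"] p assms(3) by simp
    moreover have "ys ! j + \<Delta> \<le> xs ! (i - 1)" using link p q by simp
    ultimately show ?thesis by simp
  qed
  moreover have "sorted_wrt (\<lambda>a b. b + \<Delta> \<le> a) (take i xs)"
    "sorted_wrt (\<lambda>a b. b + \<Delta> \<le> a) (drop j ys)"
    using xs ys by (auto simp: chain_def sorted_wrt_take sorted_wrt_drop)
  ultimately show ?thesis
    using xs ys by (auto simp: chain_def sorted_wrt_append dest: in_set_takeD in_set_dropD)
qed

text \<open>
  \<open>i\<close> is the least index at which the head of \<open>ys\<close>, shifted by \<open>s\<close>, can be followed by the tail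
  of \<open>xs\<close>. Minimality forces \<open>ys\<close> to lag behind, so that the opposite splice is separated, too.
\<close>

lemma chain_exchange_at:
  assumes xs: "chain \<Delta> d xs" and ys: "chain \<Delta> d ys"
    and "i \<le> length xs" "length xs + s \<le> length ys"
    and link: "i < length xs \<Longrightarrow> 0 < i + s \<Longrightarrow> xs ! i + \<Delta> \<le> ys ! (i + s - 1)"
    and least: "\<And>j. j < i \<Longrightarrow> 0 < j + s \<and> ys ! (j + s - 1) < xs ! j + \<Delta>"
  shows "chain \<Delta> d (take i xs @ drop (i + s) ys)" "chain \<Delta> d (take (i + s) ys @ drop i xs)"
proof -
  show "chain \<Delta> d (take i xs @ drop (i + s) ys)"
  proof (rule chain_take_append_drop[OF xs ys assms(3)])
    assume i: "0 < i" "i + s < length ys"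
    with least[of "i - 1"] have *: "2 \<le> i + s" "ys ! (i + s - 2) < xs ! (i - 1) + \<Delta>"
      by (auto simp: numeral_2_eq_2)
    \<comment> \<open>Failure of the link at \<open>i - 1\<close> leaves \<open>ys\<close> ahead by
      less than \<Delta>. The gap after entry \<open>i + s - 2\<close> of \<open>ys\<close> uses up
      this slack, and the gap after entry \<open>i + s - 1\<close> is the required one.\<close>
    have "ys ! (i + s) + \<Delta> \<le> ys ! (i + s - 1)" "ys ! (i + s - 1) + \<Delta> \<le> ys ! (i + s - 2)"
      using chain_nth_gap[OF ys, of "i + s - 1" "i + s"]
        chain_nth_gap[OF ys, of "i + s - 2" "i + s - 1"] i * by simp_all
    with * show "ys ! (i + s) + \<Delta> \<le> xs ! (i - 1)" by simp
  qed
  show "chain \<Delta> d (take (i + s) ys @ drop i xs)"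
    using assms(3,4) link by (intro chain_take_append_drop[OF ys xs]) simp_all
qed

lemma sum_list_exchange:
  fixes f :: "'a \<Rightarrow> int"
  shows "(\<Sum>x\<leftarrow>take i xs @ drop j ys. f x) + (\<Sum>x\<leftarrow>take j ys @ drop i xs. f x)
    = (\<Sum>x\<leftarrow>xs. f x) + (\<Sum>x\<leftarrow>ys. f x)"
proof -
  have "(\<Sum>x\<leftarrow>take n zs. f x) + (\<Sum>x\<leftarrow>drop n zs. f x) = (\<Sum>x\<leftarrow>zs. f x)" for n zs
    by (metis append_take_drop_id map_append sum_list_append)
  from this[of i xs] this[of j ys] show ?thesis by simp
qed

text \<open>Discrete concavity of the optimal value in the size. Cutting \<open>xs\<close> at
  \<open>i\<close> and \<open>ys\<close> at \<open>i + s\<close> gives the first splice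
  \<open>i + (length ys - (i + s)) = n\<close> entries, and both splices together reuse exactly the
  entries of the two lists, so the equation holds for every \<mu> at once.\<close>

lemma chain_exchange:
  assumes xs: "chain \<Delta> d xs" and ys: "chain \<Delta> d ys"
    and n: "length xs \<le> n" "n \<le> length ys"
  obtains us vs where "chain \<Delta> d us" "chain \<Delta> d vs" "length us = n"
    "length vs = length xs + length ys - n"
    "\<And>\<mu>. lagrangian f \<mu> us + lagrangian f \<mu> vs = lagrangian f \<mu> xs + lagrangian f \<mu> ys"
proof -
  define s where "s = length ys - n"
  \<comment> \<open>\<open>P i\<close> allows the first \<open>i + s\<close> entries of
    \<open>ys\<close> to be followed by the tail of \<open>xs\<close> from \<open>i\<close>. It is
    trivial when one of the two parts is empty, which makes \<open>length xs\<close> a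
    witness.\<close>
  define P where "P i \<longleftrightarrow> \<not> (i < length xs \<and> 0 < i + s \<and> ys ! (i + s - 1) < xs ! i + \<Delta>)" for i
  define i where "i = (LEAST i. P i)"
  have ex: "P (length xs)" by (simp add: P_def)
  have i: "i \<le> length xs" "P i" unfolding i_def using ex by (auto intro: Least_le LeastI)
  have "\<not> P j" if "j < i" for j using that unfolding i_def by (rule not_less_Least)
  then have least: "0 < j + s \<and> ys ! (j + s - 1) < xs ! j + \<Delta>" if "j < i" for j
    using that unfolding P_def by blast
  have link: "xs ! i + \<Delta> \<le> ys ! (i + s - 1)" if "i < length xs" "0 < i + s"
    using i(2) that unfolding P_def by linarith
  have "length xs + s \<le> length ys" using n by (simp add: s_def)
  note * = chain_exchange_at[OF xs ys i(1) this link least]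
  show ?thesis
  proof (rule that[OF *])
    show len: "length (take i xs @ drop (i + s) ys) = n"
      "length (take (i + s) ys @ drop i xs) = length xs + length ys - n"
      using i n by (auto simp: s_def)
    show "lagrangian f \<mu> (take i xs @ drop (i + s) ys) + lagrangian f \<mu> (take (i + s) ys @ drop i xs)
      = lagrangian f \<mu> xs + lagrangian f \<mu> ys" for \<mu>
    proof -
      have "int (length (take i xs @ drop (i + s) ys)) + int (length (take (i + s) ys @ drop i xs))
        = int (length xs) + int (length ys)" unfolding len using n by simp
      then have "\<mu> * int (length (take i xs @ drop (i + s) ys))
          + \<mu> * int (length (take (i + s) ys @ drop i xs))
        = \<mu> * int (length xs) + \<mu> * int (length ys)" by (metis distrib_left)
      with sum_list_exchange[of f i xs "i + s" ys] show ?thesis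
        unfolding lagrangian_def by linarith
    qed
  qed
qed

section \<open>Parity and optima at neighbouring multipliers\<close>

lemma optimal_chain: "optimal \<Delta> d f \<mu> xs \<Longrightarrow> chain \<Delta> d xs"
  by (simp add: optimal_def)

lemma optimalD: "optimal \<Delta> d f \<mu> xs \<Longrightarrow> chain \<Delta> d ys \<Longrightarrow> lagrangian f \<mu> ys \<le> lagrangian f \<mu> xs"
  by (simp add: optimal_def)

lemma lagrangian_shift: "lagrangian f (\<mu> + a) xs = lagrangian f \<mu> xs - a * int (length xs)"
  by (simp add: lagrangian_def algebra_simps)

lemma even_lagrangian:
  assumes "\<And>x. even (f x)" "even \<mu>"
  shows "even (lagrangian f \<mu> xs)"
proof -
  have "even (\<Sum>x\<leftarrow>xs. f x)" by (induction xs) (auto simp: assms)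
  with assms(2) show ?thesis by (simp add: lagrangian_def)
qed

text \<open>For even weights all slopes of the concave size profile are even.\<close>

lemma optimal_length_unique:
  assumes f: "\<And>x. even (f x)" and "odd \<mu>"
    and xs: "optimal \<Delta> d f \<mu> xs" and ys: "optimal \<Delta> d f \<mu> ys"
  shows "length xs = length ys"
proof -
  have False if xs: "optimal \<Delta> d f \<mu> xs" and ys: "optimal \<Delta> d f \<mu> ys" and less: "length xs < length ys"
    for xs ys
  proof -
    obtain us vs where uv: "chain \<Delta> d us" "chain \<Delta> d vs" "length us = Suc (length xs)"
        "length vs = length xs + length ys - Suc (length xs)"
      and eq: "\<And>\<mu>. lagrangian f \<mu> us + lagrangian f \<mu> vs = lagrangian f \<mu> xs + lagrangian f \<mu> ys"
      by (rule chain_exchange[where f = f, OF optimal_chain[OF xs] optimal_chain[OF ys] le_SucI[OF order_refl]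
            Suc_leI[OF less]]) (rule that)
    \<comment> \<open>Neither splice exceeds the optimum and their sum is twice the optimum, so both
      attain it. \<open>us\<close> has one element more than \<open>xs\<close>, hence at the even
      multiplier \<open>\<mu> + 1\<close> the two values differ by exactly 1, although both are
      even.\<close>
    have "lagrangian f \<mu> us = lagrangian f \<mu> xs"
      using optimalD[OF xs uv(1)] optimalD[OF ys uv(2)] eq[of \<mu>] by simp
    moreover have "even (lagrangian f (\<mu> + 1) us)" "even (lagrangian f (\<mu> + 1) xs)"
      using f \<open>odd \<mu>\<close> by (auto intro: even_lagrangian)
    ultimately show False by (simp add: lagrangian_shift uv(3))
  qed
  from this[OF xs ys] this[OF ys xs] show ?thesis by (meson linorder_neqE_nat)
qed

text \<open>When the multiplier drops by 1, a list gains on \<open>xs\<close> as much as it is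
  longer. A list with at most one extra element gains at most 1, and parity rules out a lead of 1. A
  longer list is exchanged with \<open>xs\<close> into one of size \<open>Suc (length xs)\<close>
  and one shorter than itself, which the induction covers.\<close>

lemma optimal_from_above:
  assumes f: "\<And>x. even (f x)" and "even \<mu>" and xs: "optimal \<Delta> d f (\<mu> + 1) xs"
  shows "optimal \<Delta> d f \<mu> xs"
proof -
  have "lagrangian f \<mu> ys \<le> lagrangian f \<mu> xs" if "chain \<Delta> d ys" for ys
    using that
  proof (induction "length ys" arbitrary: ys rule: less_induct)
    case less
    have short: "lagrangian f \<mu> zs \<le> lagrangian f \<mu> xs"
      if "chain \<Delta> d zs" "length zs \<le> Suc (length xs)" for zs
    proof -
      have "lagrangian f \<mu> zs \<le> lagrangian f \<mu> xs + 1"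
        using optimalD[OF xs that(1)] that(2) by (simp add: lagrangian_shift)
      moreover have "even (lagrangian f \<mu> zs)" "even (lagrangian f \<mu> xs)"
        using assms by (auto intro: even_lagrangian)
      ultimately show ?thesis by presburger
    qed
    show ?case
    proof (cases "length ys \<le> Suc (length xs)")
      case False
      obtain us vs where uv: "chain \<Delta> d us" "chain \<Delta> d vs" "length us = Suc (length xs)"
          "length vs = length xs + length ys - Suc (length xs)"
        and eq: "\<And>\<mu>. lagrangian f \<mu> us + lagrangian f \<mu> vs = lagrangian f \<mu> xs + lagrangian f \<mu> ys"
        by (rule chain_exchange[where f = f, OF optimal_chain[OF xs] less.prems le_SucI[OF order_refl]])
          (use False in auto)
      have "lagrangian f \<mu> vs \<le> lagrangian f \<mu> xs" using False uv by (intro less.hyps) auto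
      with short[OF uv(1)] uv(3) eq[of \<mu>] show ?thesis by simp
    qed (use short less.prems in simp)
  qed
  with optimal_chain[OF xs] show ?thesis by (simp add: optimal_def)
qed

text \<open>Mirror image: when the multiplier rises by 1, lists at most one element shorter than
  \<open>xs\<close> gain at most 1, and still shorter ones are lengthened by exchange with
  \<open>xs\<close>.\<close>

lemma optimal_from_below:
  assumes f: "\<And>x. even (f x)" and "even \<mu>" and xs: "optimal \<Delta> d f (\<mu> - 1) xs"
  shows "optimal \<Delta> d f \<mu> xs"
proof -
  have shift: "lagrangian f (\<mu> - 1) zs = lagrangian f \<mu> zs + int (length zs)" for zs
    using lagrangian_shift[of f \<mu> "-1" zs] by simp
  have "lagrangian f \<mu> ys \<le> lagrangian f \<mu> xs" if "chain \<Delta> d ys" for ys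
    using that
  proof (induction "length xs - length ys" arbitrary: ys rule: less_induct)
    case less
    have long: "lagrangian f \<mu> zs \<le> lagrangian f \<mu> xs"
      if "chain \<Delta> d zs" "length xs \<le> Suc (length zs)" for zs
    proof -
      have "lagrangian f \<mu> zs \<le> lagrangian f \<mu> xs + 1"
        using optimalD[OF xs that(1)] that(2) by (simp add: shift)
      moreover have "even (lagrangian f \<mu> zs)" "even (lagrangian f \<mu> xs)"
        using assms by (auto intro: even_lagrangian)
      ultimately show ?thesis by presburger
    qed
    show ?case
    proof (cases "length xs \<le> Suc (length ys)")
      case False
      obtain us vs where uv: "chain \<Delta> d us" "chain \<Delta> d vs" "length us = Suc (length ys)"
          "length vs = length ys + length xs - Suc (length ys)"
        and eq: "\<And>\<mu>. lagrangian f \<mu> us + lagrangian f \<mu> vs = lagrangian f \<mu> ys + lagrangian f \<mu> xs"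
        by (rule chain_exchange[where f = f, OF less.prems optimal_chain[OF xs] le_SucI[OF order_refl]])
          (use False in auto)
      have "lagrangian f \<mu> us \<le> lagrangian f \<mu> xs" using False uv by (intro less.hyps) auto
      moreover have "lagrangian f \<mu> vs \<le> lagrangian f \<mu> xs" using uv(4) by (intro long[OF uv(2)]) linarith
      ultimately show ?thesis using eq[of \<mu>] by simp
    qed (use long less.prems in simp)
  qed
  with optimal_chain[OF xs] show ?thesis by (simp add: optimal_def)
qed

text \<open>Both lists are optimal at the even multiplier between them, so the exchange makes both
  splices optimal there, too. Among lists of size \<open>n\<close>, the Lagrangian and the weight
  differ by the constant \<open>\<mu> * n\<close>. The cut \<open>i\<close> is described by
  \<open>link\<close> and \<open>least\<close>, rather than asserted to exist, so that the index
  found by the program's loop can be inserted.\<close>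

lemma optimal_exchange:
  assumes f: "\<And>x. even (f x)" and "even \<mu>"
    and xs: "optimal \<Delta> d f (\<mu> + 1) xs" and ys: "optimal \<Delta> d f (\<mu> - 1) ys"
    and n: "length xs \<le> n" "n \<le> length ys" and s: "s = length ys - n"
    and i: "i \<le> length xs"
    and link: "i < length xs \<Longrightarrow> 0 < i + s \<Longrightarrow> xs ! i + \<Delta> \<le> ys ! (i + s - 1)"
    and least: "\<And>j. j < i \<Longrightarrow> 0 < j + s \<and> ys ! (j + s - 1) < xs ! j + \<Delta>"
  defines "us \<equiv> take i xs @ drop (i + s) ys"
  shows "length us = n" "chain \<Delta> d us"
    "\<And>zs. chain \<Delta> d zs \<Longrightarrow> length zs = n \<Longrightarrow> (\<Sum>z\<leftarrow>zs. f z) \<le> (\<Sum>u\<leftarrow>us. f u)"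
proof -
  let ?vs = "take (i + s) ys @ drop i xs"
  have uv: "chain \<Delta> d us" "chain \<Delta> d ?vs"
    using chain_exchange_at[OF optimal_chain[OF xs] optimal_chain[OF ys] i _ link least] n s
    by (auto simp: us_def)
  show len: "length us = n" using i n s by (simp add: us_def)
  show "chain \<Delta> d us" by (rule uv)
  have opt: "optimal \<Delta> d f \<mu> xs" "optimal \<Delta> d f \<mu> ys"
    using optimal_from_above[OF f \<open>even \<mu>\<close> xs] optimal_from_below[OF f \<open>even \<mu>\<close> ys] by blast+
  have "length us + length ?vs = length xs + length ys"
    using i n s by (simp add: us_def)
  then have "\<mu> * int (length us) + \<mu> * int (length ?vs) = \<mu> * int (length xs) + \<mu> * int (length ys)"
    by (metis distrib_left of_nat_add)
  then have "lagrangian f \<mu> us + lagrangian f \<mu> ?vs = lagrangian f \<mu> xs + lagrangian f \<mu> ys"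
    using sum_list_exchange[of f i xs "i + s" ys] unfolding lagrangian_def us_def by linarith
  then have eq: "lagrangian f \<mu> us = lagrangian f \<mu> xs"
    using optimalD[OF opt(1) uv(1)] optimalD[OF opt(2) uv(2)] by simp
  fix zs assume "chain \<Delta> d zs" "length zs = n"
  with optimalD[OF opt(1), of zs] eq len show "(\<Sum>z\<leftarrow>zs. f z) \<le> (\<Sum>u\<leftarrow>us. f u)"
    by (simp add: lagrangian_def)
qed

section \<open>The two ends of the multiplier range\<close>

lemma sum_list_bounds:
  fixes f :: "'a \<Rightarrow> int"
  assumes "\<And>x. x \<in> set xs \<Longrightarrow> 0 \<le> f x \<and> f x \<le> M"
  shows "0 \<le> (\<Sum>x\<leftarrow>xs. f x)" "(\<Sum>x\<leftarrow>xs. f x) \<le> int (length xs) * M"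
  using assms by (induction xs) (force simp: algebra_simps)+

lemma optimal_large_multiplier:
  assumes f: "\<And>i. i \<in> {1..d} \<Longrightarrow> f i \<le> M" and "M < \<mu>" "optimal \<Delta> d f \<mu> xs"
  shows "xs = []"
proof (rule ccontr)
  assume "xs \<noteq> []"
  have "set xs \<subseteq> {1..d}" using assms(3) by (simp add: optimal_def chain_def)
  then have "(\<Sum>x\<leftarrow>xs. f x) \<le> int (length xs) * M"
    by (induction xs) (use f in \<open>force simp: algebra_simps\<close>)+
  also have "\<dots> < int (length xs) * \<mu>" using \<open>M < \<mu>\<close> \<open>xs \<noteq> []\<close> by simp
  finally show False using optimalD[OF assms(3), of "[]"] by (simp add: lagrangian_def mult.commute)
qed

text \<open>A list with fewer than \<open>k\<close> elements weighs at most \<open>M * k\<close>,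
  while the reward for a single further element already exceeds this, so \<open>ys\<close> would be
  better. Read contrapositively, a short optimum certifies that no separated \<open>k\<close>-set
  exists.\<close>

lemma optimal_small_multiplier:
  assumes f: "\<And>i. i \<in> {1..d} \<Longrightarrow> 0 \<le> f i \<and> f i \<le> M" and \<mu>: "\<mu> < - (M * int k)"
    and xs: "optimal \<Delta> d f \<mu> xs" and ys: "chain \<Delta> d ys" "length ys = k"
  shows "k \<le> length xs"
proof (rule ccontr)
  assume l: "\<not> k \<le> length xs"
  have sub: "set xs \<subseteq> {1..d}" "set ys \<subseteq> {1..d}"
    using xs ys by (auto simp: optimal_def chain_def)
  have "ys \<noteq> []" using l ys by auto
  then obtain y where "y \<in> {1..d}" using sub by (cases ys) auto
  then have "0 \<le> M" using f by force
  have "(\<Sum>x\<leftarrow>xs. f x) \<le> int (length xs) * M"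
    by (rule sum_list_bounds(2)) (use sub f in blast)
  also have "\<dots> \<le> int k * M" using l \<open>0 \<le> M\<close> by (intro mult_right_mono) auto
  also have "\<dots> < - \<mu>" using \<mu> by (simp add: mult.commute)
  also have "- \<mu> \<le> - \<mu> * (int k - int (length xs))"
  proof -
    have "0 \<le> M * int k" using \<open>0 \<le> M\<close> by simp
    then have "0 \<le> - \<mu>" "1 \<le> int k - int (length xs)" using \<mu> l by auto
    from mult_left_mono[OF this(2,1)] show ?thesis by simp
  qed
  finally have "(\<Sum>x\<leftarrow>xs. f x) - \<mu> * int (length xs) < - \<mu> * int k"
    by (simp add: algebra_simps)
  moreover have "0 \<le> (\<Sum>x\<leftarrow>ys. f x)"
    by (rule sum_list_bounds(1)[where M = M]) (use sub f in blast)
  ultimately show False using optimalD[OF xs ys(1)] ys(2) by (simp add: lagrangian_def)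
qed

section \<open>Dynamic program for a fixed multiplier\<close>

text \<open>Writing \<open>i - (\<Delta> - 1)\<close> for \<open>Suc i - \<Delta>\<close> makes the recursion terminate for \<open>\<Delta> = 0\<close>.\<close>

fun best :: "nat \<Rightarrow> (nat \<Rightarrow> int) \<Rightarrow> nat \<Rightarrow> int" where
  "best \<Delta> g 0 = 0"
| "best \<Delta> g (Suc i) = max (best \<Delta> g i) (best \<Delta> g (i - (\<Delta> - 1)) + g (Suc i))"

text \<open>A strict increase of the table at an index shows that the element was taken, so the
  values alone allow backtracking and no choices have to be recorded.\<close>

fun select :: "nat \<Rightarrow> (nat \<Rightarrow> int) \<Rightarrow> nat \<Rightarrow> nat list" where
  "select \<Delta> g 0 = []"
| "select \<Delta> g (Suc i) =
     (if best \<Delta> g i < best \<Delta> g (Suc i) then Suc i # select \<Delta> g (i - (\<Delta> - 1)) else select \<Delta> g i)"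

declare best.simps(2) [simp del] select.simps(2) [simp del]

lemma best_nonneg: "0 \<le> best \<Delta> g i"
  by (induction i) (auto simp: best.simps)

lemma best_upper:
  assumes "chain \<Delta> i xs" "1 \<le> \<Delta>"
  shows "(\<Sum>x\<leftarrow>xs. g x) \<le> best \<Delta> g i"
  using assms(1)
proof (induction i arbitrary: xs rule: less_induct)
  case (less i)
  show ?case
  proof (cases xs)
    case Nil
    then show ?thesis by (simp add: best_nonneg)
  next
    case (Cons y ys)
    with less.prems obtain j where i: "i = Suc j" and y: "y \<le> Suc j" by (cases i) (auto simp: chain_Cons)
    show ?thesis
    proof (cases "y = Suc j")
      case True
      have "chain \<Delta> (j - (\<Delta> - 1)) ys"
        using less.prems \<open>1 \<le> \<Delta>\<close> unfolding Cons True chain_Cons by (fastforce simp: chain_def)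
      then have "(\<Sum>x\<leftarrow>ys. g x) \<le> best \<Delta> g (j - (\<Delta> - 1))" by (intro less.IH) (simp_all add: i)
      then show ?thesis by (simp add: i Cons True best.simps)
    next
      case False
      have "chain \<Delta> j xs"
        using less.prems y False unfolding Cons chain_Cons by (fastforce simp: chain_def)
      then have "(\<Sum>x\<leftarrow>xs. g x) \<le> best \<Delta> g j" by (intro less.IH) (simp_all add: i)
      then show ?thesis by (simp add: i best.simps)
    qed
  qed
qed

lemma select_chain_sum:
  assumes "1 \<le> \<Delta>"
  shows "chain \<Delta> i (select \<Delta> g i) \<and> (\<Sum>x\<leftarrow>select \<Delta> g i. g x) = best \<Delta> g i"
proof (induction i rule: less_induct)
  case (less i)
  show ?case
  proof (cases i)
    case (Suc j)
    have IH: "chain \<Delta> j (select \<Delta> g j)" "(\<Sum>x\<leftarrow>select \<Delta> g j. g x) = best \<Delta> g j"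
      "chain \<Delta> (j - (\<Delta> - 1)) (select \<Delta> g (j - (\<Delta> - 1)))"
      "(\<Sum>x\<leftarrow>select \<Delta> g (j - (\<Delta> - 1)). g x) = best \<Delta> g (j - (\<Delta> - 1))"
      using less Suc by auto
    have "\<forall>y\<in>set (select \<Delta> g (j - (\<Delta> - 1))). y + \<Delta> \<le> Suc j"
      using IH(3) assms by (fastforce simp: chain_def)
    then show ?thesis
      using IH chain_mono[OF IH(1), of "Suc j"] chain_mono[OF IH(3), of "Suc j"]
      by (auto simp: Suc select.simps best.simps chain_Cons)
  qed simp
qed

lemma optimal_select:
  assumes "1 \<le> \<Delta>"
  shows "optimal \<Delta> d f \<mu> (select \<Delta> (\<lambda>i. f i - \<mu>) d)"
proof -
  have "lagrangian f \<mu> xs = (\<Sum>x\<leftarrow>xs. f x - \<mu>)" for xs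
    by (induction xs) (auto simp: lagrangian_def algebra_simps)
  then show ?thesis
    using select_chain_sum[OF assms] best_upper[OF _ assms] by (simp add: optimal_def)
qed

text \<open>A size estimate that keeps the table entries inside a machine word.\<close>

lemma best_le:
  assumes "\<And>j. j \<in> {1..i} \<Longrightarrow> g j \<le> M" "0 \<le> M"
  shows "best \<Delta> g i \<le> int i * M"
  using assms(1)
proof (induction i rule: less_induct)
  case (less i)
  show ?case
  proof (cases i)
    case (Suc j)
    have "best \<Delta> g (j - (\<Delta> - 1)) \<le> int (j - (\<Delta> - 1)) * M" using less Suc by auto
    also have "\<dots> \<le> int j * M" using assms(2) by (intro mult_right_mono) auto
    finally have "best \<Delta> g (j - (\<Delta> - 1)) \<le> int j * M" .
    moreover have "best \<Delta> g j \<le> int j * M" "g (Suc j) \<le> M" using less Suc by auto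
    ultimately show ?thesis using assms(2) by (simp add: Suc best.simps algebra_simps)
  qed simp
qed

section \<open>Projection and maximal weight\<close>

lemma sep_ge_iff:
  "enat \<Delta> \<le> sep \<Omega> \<longleftrightarrow> (\<forall>i\<in>\<Omega>. \<forall>j\<in>\<Omega>. i < j \<longrightarrow> i + \<Delta> \<le> j)"
proof
  assume *: "enat \<Delta> \<le> sep \<Omega>"
  show "\<forall>i\<in>\<Omega>. \<forall>j\<in>\<Omega>. i < j \<longrightarrow> i + \<Delta> \<le> j"
  proof (intro ballI impI)
    fix i j assume ij: "i \<in> \<Omega>" "j \<in> \<Omega>" "i < j"
    have "enat \<Delta> \<le> enat (nat \<bar>int i - int j\<bar>)"
      using * ij unfolding sep_def le_INF_iff by fastforce
    with ij show "i + \<Delta> \<le> j" by simp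
  qed
next
  assume *: "\<forall>i\<in>\<Omega>. \<forall>j\<in>\<Omega>. i < j \<longrightarrow> i + \<Delta> \<le> j"
  have "\<Delta> \<le> nat \<bar>int i - int j\<bar>" if "i \<in> \<Omega>" "j \<in> \<Omega>" "i \<noteq> j" for i j
    using that * by (cases "i < j") (fastforce simp: abs_if)+
  then show "enat \<Delta> \<le> sep \<Omega>" unfolding sep_def le_INF_iff by auto
qed

lemma sep_sets_card_iff_chain:
  assumes "1 \<le> \<Delta>"
  shows "\<Omega> \<in> sep_sets_card d k \<Delta> \<longleftrightarrow> (\<exists>zs. chain \<Delta> d zs \<and> length zs = k \<and> set zs = \<Omega>)"
proof
  assume \<Omega>: "\<Omega> \<in> sep_sets_card d k \<Delta>"
  then have sub: "\<Omega> \<subseteq> {1..d}" and card: "card \<Omega> = k"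
    and gap: "\<forall>i\<in>\<Omega>. \<forall>j\<in>\<Omega>. i < j \<longrightarrow> i + \<Delta> \<le> j"
    by (auto simp: sep_sets_card_def sep_sets_def sep_ge_iff)
  have fin: "finite \<Omega>" using sub finite_subset by blast
  have "sorted_wrt (\<lambda>a b. a + \<Delta> \<le> b) (sorted_list_of_set \<Omega>)"
    by (rule sorted_wrt_mono_rel[OF _ strict_sorted_list_of_set]) (use gap fin in auto)
  then have "chain \<Delta> d (rev (sorted_list_of_set \<Omega>))"
    using sub fin by (auto simp: chain_def sorted_wrt_rev)
  with fin card show "\<exists>zs. chain \<Delta> d zs \<and> length zs = k \<and> set zs = \<Omega>"
    by (intro exI[of _ "rev (sorted_list_of_set \<Omega>)"]) simp
next
  assume "\<exists>zs. chain \<Delta> d zs \<and> length zs = k \<and> set zs = \<Omega>"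
  then obtain zs where zs: "chain \<Delta> d zs" "length zs = k" "set zs = \<Omega>" by blast
  have "i + \<Delta> \<le> j" if "i \<in> \<Omega>" "j \<in> \<Omega>" "i < j" for i j
  proof -
    from that zs(3) obtain p q where pq: "p < length zs" "zs ! p = i" "q < length zs" "zs ! q = j"
      by (metis in_set_conv_nth)
    have "q < p" using chain_nth_mono[OF zs(1), of p q] pq that by (meson leD not_le)
    then show ?thesis using chain_nth_gap[OF zs(1), of q p] pq by simp
  qed
  moreover have "card \<Omega> = k" using distinct_card[OF chain_distinct[OF zs(1) assms]] zs by simp
  ultimately show "\<Omega> \<in> sep_sets_card d k \<Delta>"
    using zs by (auto simp: sep_sets_card_def sep_sets_def sep_ge_iff chain_def)
qed

section \<open>Squared distance and captured energy\<close>

definition sq_dist :: "nat \<Rightarrow> (nat \<Rightarrow> real) \<Rightarrow> (nat \<Rightarrow> real) \<Rightarrow> real" where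
  "sq_dist d x y = (\<Sum>i\<in>{1..d}. (x i - y i)\<^sup>2)"

lemma l2_dist_less_iff: "l2_dist d x y < l2_dist d x z \<longleftrightarrow> sq_dist d x y < sq_dist d x z"
  by (simp add: l2_dist_def L2_set_def sq_dist_def)

lemma sq_dist_lower:
  assumes "supp d y \<subseteq> \<Omega>" "\<Omega> \<subseteq> {1..d}"
  shows "(\<Sum>i\<in>{1..d}. (x i)\<^sup>2) - (\<Sum>i\<in>\<Omega>. (x i)\<^sup>2) \<le> sq_dist d x y"
proof -
  have "(\<Sum>i\<in>{1..d}. (x i)\<^sup>2) - (\<Sum>i\<in>\<Omega>. (x i)\<^sup>2) = (\<Sum>i\<in>{1..d} - \<Omega>. (x i)\<^sup>2)"
    using assms(2) by (simp add: sum_diff)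
  also have "\<dots> = (\<Sum>i\<in>{1..d} - \<Omega>. (x i - y i)\<^sup>2)"
    using assms(1) by (intro sum.cong) (auto simp: supp_def)
  also have "\<dots> \<le> sq_dist d x y"
    unfolding sq_dist_def by (intro sum_mono2) auto
  finally show ?thesis .
qed

text \<open>The error \<epsilon> is 0 for the vector that copies \<open>x\<close> on \<Omega>, and
  positive for vectors that replace zero coefficients in order to have support exactly
  \<Omega>.\<close>

lemma sq_dist_restrict:
  assumes "\<Omega> \<subseteq> {1..d}" "\<And>i. i \<in> \<Omega> \<Longrightarrow> \<bar>x i - y i\<bar> \<le> \<epsilon>" "\<And>i. i \<in> {1..d} - \<Omega> \<Longrightarrow> y i = 0"
  shows "sq_dist d x y \<le> (\<Sum>i\<in>{1..d}. (x i)\<^sup>2) - (\<Sum>i\<in>\<Omega>. (x i)\<^sup>2) + real (card \<Omega>) * \<epsilon>\<^sup>2"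
proof -
  have fin: "finite \<Omega>" using assms(1) finite_subset by blast
  have "sq_dist d x y = (\<Sum>i\<in>{1..d} - \<Omega>. (x i - y i)\<^sup>2) + (\<Sum>i\<in>\<Omega>. (x i - y i)\<^sup>2)"
    unfolding sq_dist_def using assms(1) by (simp add: sum.subset_diff)
  also have "(\<Sum>i\<in>{1..d} - \<Omega>. (x i - y i)\<^sup>2) = (\<Sum>i\<in>{1..d} - \<Omega>. (x i)\<^sup>2)"
    using assms(3) by (intro sum.cong) auto
  also have "\<dots> = (\<Sum>i\<in>{1..d}. (x i)\<^sup>2) - (\<Sum>i\<in>\<Omega>. (x i)\<^sup>2)"
    using assms(1) by (simp add: sum_diff)
  also have "(\<Sum>i\<in>\<Omega>. (x i - y i)\<^sup>2) \<le> (\<Sum>i\<in>\<Omega>. \<epsilon>\<^sup>2)"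
    using assms(2) by (intro sum_mono) (force simp flip: abs_le_square_iff)
  finally show ?thesis using fin by simp
qed

text \<open>
  The weight orders the \<open>k\<close>-element sets by energy first and by the number of nonzero coefficients
  second. The second criterion makes the support of the output as large as possible, which matters
  for the problem with support of size exactly \<open>k\<close>. The factor 2 makes all weights even.
\<close>

definition weight :: "nat \<Rightarrow> (nat \<Rightarrow> int) \<Rightarrow> nat \<Rightarrow> int" where
  "weight k m i = 2 * ((int k + 1) * (m i * m i) + (if m i = 0 then 0 else 1))"

lemma sum_weight:
  assumes "finite \<Omega>"
  shows "(\<Sum>i\<in>\<Omega>. weight k m i) =
    2 * ((int k + 1) * (\<Sum>i\<in>\<Omega>. m i * m i) + int (card {i\<in>\<Omega>. m i \<noteq> 0}))"
proof -
  have "(\<Sum>i\<in>\<Omega>. if m i = 0 then 0 else 1 :: int) = int (card {i\<in>\<Omega>. m i \<noteq> 0})"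
    using assms by (simp add: sum.If_cases Int_def)
  then show ?thesis
    by (simp add: weight_def sum.distrib sum_distrib_left[symmetric] del: distrib_left_numeral)
qed

text \<open>The number of nonzero coefficients is at most \<open>k\<close> and energies are
  integers, so the factor \<open>k + 1\<close> keeps this number from outweighing a difference in
  energy. At equal energy the numbers are compared, and a set without zero coefficients has the
  largest possible one.\<close>

lemma weight_order:
  assumes fin: "finite \<Omega>" "finite \<Omega>'" and card: "card \<Omega> = k" "card \<Omega>' = k"
    and le: "(\<Sum>i\<in>\<Omega>'. weight k m i) \<le> (\<Sum>i\<in>\<Omega>. weight k m i)"
  shows "(\<Sum>i\<in>\<Omega>'. m i * m i) \<le> (\<Sum>i\<in>\<Omega>. m i * m i)"
    and "(\<Sum>i\<in>\<Omega>. m i * m i) \<le> (\<Sum>i\<in>\<Omega>'. m i * m i) \<Longrightarrow> \<forall>i\<in>\<Omega>'. m i \<noteq> 0 \<Longrightarrow> \<forall>i\<in>\<Omega>. m i \<noteq> 0"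
proof -
  let ?a = "\<Sum>i\<in>\<Omega>. m i * m i" and ?b = "\<Sum>i\<in>\<Omega>'. m i * m i"
  let ?p = "card {i\<in>\<Omega>. m i \<noteq> 0}" and ?q = "card {i\<in>\<Omega>'. m i \<noteq> 0}"
  have p: "?p \<le> k" using fin card by (metis (no_types, lifting) card_mono mem_Collect_eq subsetI)
  have le': "(int k + 1) * ?b + int ?q \<le> (int k + 1) * ?a + int ?p"
    using le fin by (simp add: sum_weight)
  then have "(int k + 1) * (?b - ?a) < (int k + 1) * 1"
    using p by (simp add: right_diff_distrib)
  then have "?b - ?a < 1" by (subst (asm) mult_less_cancel_left_pos) auto
  then show ab: "?b \<le> ?a" by simp
  assume "?a \<le> ?b" and nz: "\<forall>i\<in>\<Omega>'. m i \<noteq> 0"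
  then have "?a = ?b" using ab by simp
  then have "?q \<le> ?p" using le' by simp
  moreover have "{i\<in>\<Omega>'. m i \<noteq> 0} = \<Omega>'" using nz by auto
  ultimately have "card \<Omega> \<le> ?p" using card by simp
  then have "{i\<in>\<Omega>. m i \<noteq> 0} = \<Omega>" using fin by (intro card_seteq) auto
  then show "\<forall>i\<in>\<Omega>. m i \<noteq> 0" by blast
qed

text \<open>For supports contained in a set, the best vector copies \<open>x\<close> on a set of
  maximal energy. For supports of exact size \<open>k\<close> a minimizer \<open>z\<close> has to be
  assumed. Its existence means that some set of maximal energy avoids the zeros of \<open>x\<close>;
  by the tie-break in the weight \<Omega> then avoids them as well, and \<open>xhat\<close> has full
  support \<Omega>.\<close>

lemma argmin_of_max_weight:
  fixes x :: "nat \<Rightarrow> real"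
  assumes x: "\<forall>i\<in>{1..d}. x i = decode e m i"
    and \<Omega>: "\<Omega> \<in> sep_sets_card d k \<Delta>"
    and max: "\<And>\<Omega>'. \<Omega>' \<in> sep_sets_card d k \<Delta> \<Longrightarrow> (\<Sum>i\<in>\<Omega>'. weight k m i) \<le> (\<Sum>i\<in>\<Omega>. weight k m i)"
  defines "xhat \<equiv> decode e (\<lambda>i. if i \<in> \<Omega> then m i else 0)"
  shows "is_arg_min (l2_dist d x) (\<lambda>x'. \<exists>\<Omega>\<in>sep_sets_card d k \<Delta>. supp d x' \<subseteq> \<Omega>) xhat"
    and "is_arg_min (l2_dist d x) (\<lambda>x'. supp d x' \<in> sep_sets_card d k \<Delta>) z \<Longrightarrow>
      is_arg_min (l2_dist d x) (\<lambda>x'. supp d x' \<in> sep_sets_card d k \<Delta>) xhat"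
proof -
  let ?F = "sep_sets_card d k \<Delta>"
  let ?E = "\<lambda>\<Omega>. \<Sum>i\<in>\<Omega>. (x i)\<^sup>2"
  have F: "\<Omega>' \<subseteq> {1..d}" "finite \<Omega>'" "card \<Omega>' = k" if "\<Omega>' \<in> ?F" for \<Omega>'
    using that finite_subset[of \<Omega>' "{1..d}"] by (auto simp: sep_sets_card_def sep_sets_def)
  have E: "?E \<Omega>' = (2 powi e)\<^sup>2 * of_int (\<Sum>i\<in>\<Omega>'. m i * m i)" if "\<Omega>' \<in> ?F" for \<Omega>'
  proof -
    have "?E \<Omega>' = (\<Sum>i\<in>\<Omega>'. (2 powi e)\<^sup>2 * of_int (m i * m i))"
      using x F(1)[OF that] by (intro sum.cong) (auto simp: decode_def power2_eq_square)
    then show ?thesis by (simp add: sum_distrib_left)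
  qed
  have E_le: "?E \<Omega>' \<le> ?E \<Omega>'' \<longleftrightarrow> (\<Sum>i\<in>\<Omega>'. m i * m i) \<le> (\<Sum>i\<in>\<Omega>''. m i * m i)"
    if "\<Omega>' \<in> ?F" "\<Omega>'' \<in> ?F" for \<Omega>' \<Omega>''
    unfolding E[OF that(1)] E[OF that(2)] by (simp add: mult_le_cancel_left_pos flip: of_int_sum of_int_mult)
  have E_max: "?E \<Omega>' \<le> ?E \<Omega>" if "\<Omega>' \<in> ?F" for \<Omega>'
    unfolding E_le[OF that \<Omega>] using F[OF that] F[OF \<Omega>] max[OF that] by (intro weight_order(1)) auto
  have xhat: "xhat i = (if i \<in> \<Omega> then x i else 0)" if "i \<in> {1..d}" for i
    using that x by (simp add: xhat_def decode_def)
  have supp_sub: "supp d xhat \<subseteq> \<Omega>" using xhat by (auto simp: supp_def split: if_splits)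
  have upper: "sq_dist d x xhat \<le> ?E {1..d} - ?E \<Omega>"
  proof -
    have "\<bar>x i - xhat i\<bar> \<le> 0" if "i \<in> \<Omega>" for i using that xhat[of i] F(1)[OF \<Omega>] by auto
    from sq_dist_restrict[OF F(1)[OF \<Omega>] this] show ?thesis by (simp add: xhat)
  qed
  have lower: "sq_dist d x xhat \<le> sq_dist d x y" if "\<Omega>' \<in> ?F" "supp d y \<subseteq> \<Omega>'" for y \<Omega>'
    using sq_dist_lower[OF that(2) F(1)[OF that(1)], of x] upper E_max[OF that(1)] by linarith
  show "is_arg_min (l2_dist d x) (\<lambda>x'. \<exists>\<Omega>\<in>?F. supp d x' \<subseteq> \<Omega>) xhat"
    unfolding is_arg_min_def l2_dist_less_iff not_ex de_Morgan_conj not_less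
    using \<Omega> supp_sub lower by blast
  assume z: "is_arg_min (l2_dist d x) (\<lambda>x'. supp d x' \<in> ?F) z"
  define \<Omega>' where "\<Omega>' = supp d z"
  have \<Omega>': "\<Omega>' \<in> ?F" using z by (simp add: is_arg_min_def \<Omega>'_def)
  have z_min: "sq_dist d x z \<le> sq_dist d x y" if "supp d y \<in> ?F" for y
    using z that unfolding is_arg_min_def l2_dist_less_iff by (meson not_less)
  \<comment> \<open>Where \<open>x\<close> vanishes, halving \<open>z i\<close> keeps the support
    and strictly decreases the distance, which contradicts minimality of \<open>z\<close>.\<close>
  have "x i \<noteq> 0" if i: "i \<in> \<Omega>'" for i
  proof
    assume "x i = 0"
    let ?y = "z(i := z i / 2)"
    have i': "i \<in> {1..d}" "z i \<noteq> 0" using i by (auto simp: \<Omega>'_def supp_def)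
    have "supp d ?y = \<Omega>'" using i' by (auto simp: \<Omega>'_def supp_def)
    then have "sq_dist d x z \<le> sq_dist d x ?y" using \<Omega>' z_min by simp
    moreover have "sq_dist d x ?y < sq_dist d x z"
      unfolding sq_dist_def
    proof (rule sum_strict_mono_ex1)
      have less: "(z i / 2)\<^sup>2 < (z i)\<^sup>2" using i' by (simp add: power_divide)
      then show "\<forall>j\<in>{1..d}. (x j - ?y j)\<^sup>2 \<le> (x j - z j)\<^sup>2" using \<open>x i = 0\<close> by auto
      show "\<exists>j\<in>{1..d}. (x j - ?y j)\<^sup>2 < (x j - z j)\<^sup>2" using less i' \<open>x i = 0\<close> by (intro bexI[of _ i]) auto
    qed simp
    ultimately show False by simp
  qed
  then have nz: "\<forall>i\<in>\<Omega>'. m i \<noteq> 0" using x F(1)[OF \<Omega>'] by (metis decode_def in_mono mult_zero_left of_int_0)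
  \<comment> \<open>Replacing the zeros of \<open>x\<close> inside \<Omega> by \<epsilon> gives an
    admissible competitor. It exceeds the bound by at most \<open>k * \<epsilon>\<^sup>2\<close>,
    and \<epsilon> is chosen to make this at most \<delta>.\<close>
  have "sq_dist d x z \<le> ?E {1..d} - ?E \<Omega>"
  proof (rule field_le_epsilon)
    fix \<delta> :: real assume "0 < \<delta>"
    define \<epsilon> where "\<epsilon> = sqrt (\<delta> / (real k + 1))"
    have "0 < \<epsilon>" using \<open>0 < \<delta>\<close> by (simp add: \<epsilon>_def)
    let ?y = "\<lambda>i. if i \<in> \<Omega> then (if x i = 0 then \<epsilon> else x i) else 0"
    have "supp d ?y = \<Omega>" using F(1)[OF \<Omega>] \<open>0 < \<epsilon>\<close> by (auto simp: supp_def)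
    then have "sq_dist d x z \<le> sq_dist d x ?y" using z_min \<Omega> by simp
    also have "\<dots> \<le> ?E {1..d} - ?E \<Omega> + real (card \<Omega>) * \<epsilon>\<^sup>2"
      using \<open>0 < \<epsilon>\<close> by (intro sq_dist_restrict F(1)[OF \<Omega>]) auto
    also have "real (card \<Omega>) * \<epsilon>\<^sup>2 \<le> \<delta>"
      using \<open>0 < \<delta>\<close> F(3)[OF \<Omega>] by (simp add: \<epsilon>_def field_simps)
    finally show "sq_dist d x z \<le> ?E {1..d} - ?E \<Omega> + \<delta>" by simp
  qed
  moreover have "?E {1..d} - ?E \<Omega>' \<le> sq_dist d x z"
    by (rule sq_dist_lower) (use F(1)[OF \<Omega>'] in \<open>auto simp: \<Omega>'_def\<close>)
  \<comment> \<open>So the support of \<open>z\<close> also has maximal energy, and the second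
    criterion of the weight decides.\<close>
  ultimately have "?E \<Omega> \<le> ?E \<Omega>'" by simp
  then have "\<forall>i\<in>\<Omega>. m i \<noteq> 0"
    unfolding E_le[OF \<Omega> \<Omega>'] using F[OF \<Omega>] F[OF \<Omega>'] max[OF \<Omega>'] nz
    by (intro weight_order(2)[of \<Omega> \<Omega>' k m]) auto
  then have "supp d xhat = \<Omega>"
    using F(1)[OF \<Omega>] by (auto simp: supp_def xhat_def decode_def)
  then show "is_arg_min (l2_dist d x) (\<lambda>x'. supp d x' \<in> ?F) xhat"
    unfolding is_arg_min_def l2_dist_less_iff not_ex de_Morgan_conj not_less
    using \<Omega> lower by blast
qed

section \<open>Binary lengths\<close>

lemma bits_bounds: "0 < bits n" "\<bar>n\<bar> \<le> 2 ^ (bits n - 1)" "n < 2 ^ (bits n - 1)"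
proof -
  let ?P = "\<lambda>b. 0 < b \<and> - (2 ^ (b - 1)) \<le> n \<and> n < (2 :: int) ^ (b - 1)"
  have "\<bar>n\<bar> < 2 ^ nat \<bar>n\<bar>" using less_exp[of "nat \<bar>n\<bar>"]
    by (metis abs_ge_zero int_nat_eq of_nat_less_numeral_power_cancel_iff)
  then have "?P (Suc (nat \<bar>n\<bar>))" by (simp add: abs_if split: if_splits)
  then have "?P (bits n)" unfolding bits_def by (rule LeastI)
  then show "0 < bits n" "\<bar>n\<bar> \<le> 2 ^ (bits n - 1)" "n < 2 ^ (bits n - 1)" by auto
qed

text \<open>The magnitude takes one bit more than the rounded-down logarithm, and the sign takes
  another.\<close>

lemma bits_le_log:
  assumes "1 \<le> k"
  shows "real (bits (int k)) \<le> log 2 (real k) + 2"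
proof -
  define b where "b = nat \<lfloor>log 2 (real k)\<rfloor>"
  have b: "int b = \<lfloor>log 2 (real k)\<rfloor>" using assms by (simp add: b_def)
  have "log 2 (real k) < real (Suc b)" using b by linarith
  then have "real k < 2 powr real (Suc b)" using assms by (subst (asm) log_less_iff) auto
  then have "real k < 2 ^ Suc b" by (simp only: powr_realpow zero_less_numeral)
  then have "int k < 2 ^ Suc b" by (metis of_int_less_iff of_int_numeral of_int_of_nat_eq of_int_power)
  then have "bits (int k) \<le> Suc (Suc b)"
    unfolding bits_def by (intro Least_le) (auto intro: order_trans[of _ 0])
  moreover have "real b \<le> log 2 (real k)" using b by linarith
  ultimately show ?thesis by linarith
qed

section \<open>The program\<close>

abbreviation seq (infixr ";;" 60) where "c1 ;; c2 \<equiv> Seq c1 c2"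

text \<open>The guard avoids a negative index, on which the machine would be stuck. For
  \<open>i \<le> \<Delta>\<close> the entry to be read would be the table value at 0, which is
  0.\<close>

definition dp_body :: com where
  "dp_body =
     Assign ''i'' (Add (Var ''i'') (Const 1)) ;;
     Assign ''u'' (Const 0) ;;
     Cond (Less (Var ''Delta'') (Var ''i''))
       (Assign ''u'' (Elem ''V'' (Sub (Var ''i'') (Var ''Delta'')))) Skip ;;
     Assign ''u'' (Add (Var ''u'') (Sub (Elem ''c'' (Var ''i'')) (Var ''lam''))) ;;
     Cond (Less (Elem ''V'' (Sub (Var ''i'') (Const 1))) (Var ''u''))
       (Store ''V'' (Var ''i'') (Var ''u''))
       (Store ''V'' (Var ''i'') (Elem ''V'' (Sub (Var ''i'') (Const 1))))"

definition dp_com :: com where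
  "dp_com = (Store ''V'' (Const 0) (Const 0) ;; Assign ''i'' (Const 0)) ;;
     While (Less (Var ''i'') (Var ''d'')) dp_body"

text \<open>Resetting a negative \<open>i\<close> to 0 imitates truncated subtraction on
  \<open>nat\<close>.\<close>

definition select_body :: "vname \<Rightarrow> com" where
  "select_body a =
     Cond (Less (Elem ''V'' (Sub (Var ''i'') (Const 1))) (Elem ''V'' (Var ''i'')))
       (Assign ''n'' (Add (Var ''n'') (Const 1)) ;;
        Store a (Var ''n'') (Var ''i'') ;;
        Assign ''i'' (Sub (Var ''i'') (Var ''Delta'')) ;;
        Cond (Less (Var ''i'') (Const 0)) (Assign ''i'' (Const 0)) Skip)
       (Assign ''i'' (Sub (Var ''i'') (Const 1)))"

definition select_com :: "vname \<Rightarrow> com" where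
  "select_com a =
     (Assign ''i'' (Var ''d'') ;; Assign ''n'' (Const 0) ;;
      Store a (Const 0) (Add (Var ''d'') (Var ''Delta''))) ;;
     While (Less (Const 0) (Var ''i'')) (select_body a) ;;
     Store a (Add (Var ''n'') (Const 1)) (Sub (Const 0) (Var ''Delta''))"

definition solve_com :: "vname \<Rightarrow> com" where
  "solve_com a = dp_com ;; select_com a"

text \<open>
  The sentinels \<open>d + \<Delta>\<close> and \<open>-\<Delta>\<close> around the list make the loop test of \<open>splice_com\<close> fail on its
  own at either end.
\<close>

definition stored :: "nat \<Rightarrow> nat \<Rightarrow> nat list \<Rightarrow> (nat \<Rightarrow> int) \<Rightarrow> bool" where
  "stored d \<Delta> xs A \<longleftrightarrow> A 0 = int d + int \<Delta> \<and> (\<forall>j<length xs. A (Suc j) = int (xs ! j)) \<and>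
     A (Suc (length xs)) = - int \<Delta>"

text \<open>\<open>M\<close> bounds the weights and \<open>L\<close> the absolute value of every
  multiplier \<open>2 * l + 1\<close> with \<open>l\<close> between \<open>- (M * k) - 1\<close> and
  \<open>M + 1\<close>. Table entries are then at most \<open>d * (M + L)\<close>, and
  \<open>W_large\<close> leaves room for all values that occur in an evaluation. \<open>W\<close>
  names the power \<open>2 ^ w\<close> so that linear arithmetic can treat it as an atom.\<close>

locale problem =
  fixes w d k \<Delta> :: nat and f :: "nat \<Rightarrow> int" and W M L :: int
  assumes W: "W = 2 ^ w" and d: "1 \<le> d" and k: "1 \<le> k" and \<Delta>: "1 \<le> \<Delta>"
    and f: "\<And>i. i \<in> {1..d} \<Longrightarrow> 0 \<le> f i \<and> f i \<le> M" and M: "0 \<le> M"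
    and L: "L = 2 * (M * int k) + 2 * M + 3"
    and W_large: "int d * (M + L) + M + 4 * L + 4 * int d + 2 * int k + 2 * int \<Delta> + 4 < W"
begin

lemma fits_iff: "fits w v \<longleftrightarrow> - W < v \<and> v < W"
  by (auto simp: fits_def W abs_less_iff)

lemma L_nonneg: "0 \<le> L" using L M by simp

text \<open>The nonlinear terms are listed with their signs, so that all later word bounds are
  linear in these atoms.\<close>

lemma W_bounds: "0 \<le> int d * (M + L)" "0 \<le> L" "0 \<le> M" "0 \<le> M * int k"
    "int d * (M + L) + M + 4 * L + 4 * int d + 2 * int k + 2 * int \<Delta> + 4 < W"
  using M L_nonneg W_large by simp_all

lemma fits_basic [simp]:
  "fits w 0" "fits w 1" "fits w 2" "fits w (int d)" "fits w (int k)" "fits w (int \<Delta>)"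
  using W_bounds unfolding fits_iff by linarith+

definition ready :: "int \<Rightarrow> state \<Rightarrow> bool" where
  "ready \<mu> s \<longleftrightarrow> vars s ''d'' = int d \<and> vars s ''k'' = int k \<and> vars s ''Delta'' = int \<Delta> \<and>
     vars s ''lam'' = \<mu> \<and> (\<forall>i\<in>{1..d}. arrs s ''c'' i = f i)"

section \<open>Correctness of the solver for one multiplier\<close>

lemma best_bounds:
  assumes "\<bar>\<mu>\<bar> \<le> L" "j \<le> d"
  shows "0 \<le> best \<Delta> (\<lambda>i. f i - \<mu>) j" "best \<Delta> (\<lambda>i. f i - \<mu>) j \<le> int d * (M + L)"
proof -
  have "best \<Delta> (\<lambda>i. f i - \<mu>) j \<le> int j * (M + L)"
    using assms f M L_nonneg by (intro best_le) fastforce+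
  also have "\<dots> \<le> int d * (M + L)" using assms M L_nonneg by (intro mult_right_mono) auto
  finally show "best \<Delta> (\<lambda>i. f i - \<mu>) j \<le> int d * (M + L)" .
qed (rule best_nonneg)

lemma dp_body_runs:
  assumes s: "ready \<mu> s" and \<mu>: "\<bar>\<mu>\<bar> \<le> L" and i: "vars s ''i'' = int i" "i < d"
    and V: "\<forall>j\<le>i. arrs s ''V'' j = best \<Delta> (\<lambda>i. f i - \<mu>) j"
  shows "runs w dp_body s (max_cost dp_body) (\<lambda>s'. vars s' ''i'' = int (Suc i) \<and>
    (\<forall>j\<le>Suc i. arrs s' ''V'' j = best \<Delta> (\<lambda>i. f i - \<mu>) j))"
proof (rule runs_wp)
  let ?b = "best \<Delta> (\<lambda>i. f i - \<mu>)"
  have c: "arrs s ''c'' (Suc i) = f (Suc i)" "0 \<le> f (Suc i)" "f (Suc i) \<le> M"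
    using s i f by (auto simp: ready_def)
  have b: "0 \<le> ?b i" "?b i \<le> int d * (M + L)"
    "0 \<le> ?b (Suc i - \<Delta>)" "?b (Suc i - \<Delta>) \<le> int d * (M + L)"
    using best_bounds[OF \<mu>, of i] best_bounds[OF \<mu>, of "Suc i - \<Delta>"] i \<Delta> by auto
  have rec: "?b (Suc i) = max (?b i) (?b (Suc i - \<Delta>) + (f (Suc i) - \<mu>))"
  proof -
    have "i - (\<Delta> - 1) = Suc i - \<Delta>" using \<Delta> by simp
    then show ?thesis by (simp add: best.simps(2))
  qed
  have "fits w 0" "fits w 1" "fits w (int i)" "fits w (int i + 1)" "fits w (int \<Delta>)"
    "fits w (int i + 1 - int \<Delta>)" "fits w \<mu>" "fits w (f (Suc i))" "fits w (f (Suc i) - \<mu>)"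
    "fits w (?b i)" "fits w (?b (Suc i - \<Delta>))" "fits w (?b (Suc i - \<Delta>) + (f (Suc i) - \<mu>))"
    using i(2) c(2,3) b \<mu> W_bounds unfolding fits_iff by linarith+
  moreover have "arrs s ''V'' (Suc i - \<Delta>) = ?b (Suc i - \<Delta>)" "arrs s ''V'' i = ?b i"
    using V \<Delta> by simp_all
  moreover have eqs: "vars s ''Delta'' = int \<Delta>" "vars s ''lam'' = \<mu>"
    using s by (simp_all add: ready_def)
  moreover have n: "nat (int i + 1) = Suc i" "nat (int i + 1 - int \<Delta>) = Suc i - \<Delta>" by simp_all
  ultimately show "wp w dp_body (\<lambda>s'. vars s' ''i'' = int (Suc i) \<and>
      (\<forall>j\<le>Suc i. arrs s' ''V'' j = ?b j)) s"
    using eqs i(1) c(1) V by (simp add: dp_body_def rec le_Suc_eq max_def n)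
qed

lemma ready_agree:
  "ready \<mu> s \<Longrightarrow> agree c s s' \<Longrightarrow> {''d'', ''k'', ''Delta'', ''lam''} \<inter> wvars c = {} \<Longrightarrow>
    ''c'' \<notin> warrs c \<Longrightarrow> ready \<mu> s'"
  by (simp add: ready_def agree_def)

lemma dp_runs:
  assumes s: "ready \<mu> s" and \<mu>: "\<bar>\<mu>\<bar> \<le> L"
  shows "runs w dp_com s (80 * d) (\<lambda>s'. \<forall>j\<le>d. arrs s' ''V'' j = best \<Delta> (\<lambda>i. f i - \<mu>) j)"
proof -
  let ?init = "Store ''V'' (Const 0) (Const 0) ;; Assign ''i'' (Const 0)"
  let ?I = "\<lambda>n s. \<exists>i. n = d - i \<and> i \<le> d \<and> vars s ''i'' = int i \<and>
    (\<forall>j\<le>i. arrs s ''V'' j = best \<Delta> (\<lambda>i. f i - \<mu>) j)"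
  have "runs w ?init s (max_cost ?init) (?I d)"
    by (rule runs_wp) simp
  then have "runs w dp_com s (max_cost ?init + (d * (1 + bcost (Less (Var ''i'') (Var ''d''))
      + max_cost dp_body) + (1 + bcost (Less (Var ''i'') (Var ''d'')))))
    (\<lambda>s'. \<forall>j\<le>d. arrs s' ''V'' j = best \<Delta> (\<lambda>i. f i - \<mu>) j)"
    unfolding dp_com_def
  proof (rule runs_Seq_mid)
    fix s1 assume I: "?I d s1" and ag: "agree ?init s s1"
    have s1: "ready \<mu> s1" using s ag by (rule ready_agree) simp_all
    show "runs w (While (Less (Var ''i'') (Var ''d'')) dp_body) s1
      (d * (1 + bcost (Less (Var ''i'') (Var ''d'')) + max_cost dp_body)
        + (1 + bcost (Less (Var ''i'') (Var ''d''))))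
      (\<lambda>s'. \<forall>j\<le>d. arrs s' ''V'' j = best \<Delta> (\<lambda>i. f i - \<mu>) j)"
      using I
    proof (rule runs_While[where I = "?I" and N = d])
      fix n s' assume "?I n s'" and ag: "agree dp_body s1 s'"
      then obtain i where i: "n = d - i" "i \<le> d" "vars s' ''i'' = int i"
        and V: "\<forall>j\<le>i. arrs s' ''V'' j = best \<Delta> (\<lambda>i. f i - \<mu>) j" by blast
      have s': "ready \<mu> s'" using s1 ag by (rule ready_agree) (simp_all add: dp_body_def)
      then have vd: "vars s' ''d'' = int d" by (simp add: ready_def)
      have "fits w (int i)" "fits w (int d)"
        using i W_bounds unfolding fits_iff by linarith+
      then have "bsafe w s' (Less (Var ''i'') (Var ''d''))" using i vd by simp
      moreover have "\<exists>n'. n = Suc n' \<and> runs w dp_body s' (max_cost dp_body) (?I n')" if "i < d"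
      proof (intro exI conjI)
        show "n = Suc (d - Suc i)" using i that by simp
        show "runs w dp_body s' (max_cost dp_body) (?I (d - Suc i))"
          by (rule runs_weaken[OF dp_body_runs[OF s' \<mu> i(3) that V] order_refl])
            (use that in \<open>auto intro!: exI[of _ "Suc i"]\<close>)
      qed
      ultimately show "bsafe w s' (Less (Var ''i'') (Var ''d'')) \<and>
          (\<not> pbval s' (Less (Var ''i'') (Var ''d'')) \<longrightarrow>
            (\<forall>j\<le>d. arrs s' ''V'' j = best \<Delta> (\<lambda>i. f i - \<mu>) j)) \<and>
          (pbval s' (Less (Var ''i'') (Var ''d'')) \<longrightarrow>
            (\<exists>n'. n = Suc n' \<and> runs w dp_body s' (max_cost dp_body) (?I n')))"
        using i vd V by auto
    qed
  qed
  then show ?thesis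
    by (rule runs_weaken) (use d in \<open>simp_all add: dp_body_def\<close>)
qed

lemma optimal_length: "optimal \<Delta> d f \<mu> xs \<Longrightarrow> length xs \<le> d"
  using optimal_chain chain_length \<Delta> by blast

text \<open>The entries already written followed by the entries still to be found by backtracking
  remain the same list, while \<open>i\<close> strictly decreases.\<close>

lemma select_body_runs:
  assumes s: "ready \<mu> s" and \<mu>: "\<bar>\<mu>\<bar> \<le> L" and a: "a \<noteq> ''V''"
    and V: "\<forall>j\<le>d. arrs s ''V'' j = best \<Delta> (\<lambda>i. f i - \<mu>) j"
    and i: "vars s ''i'' = int (Suc i)" "Suc i \<le> d"
    and n: "vars s ''n'' = int (length ys)" "length ys \<le> d"
    and A: "arrs s a 0 = int d + int \<Delta>" "\<forall>j<length ys. arrs s a (Suc j) = int (ys ! j)"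
  shows "runs w (select_body a) s (max_cost (select_body a)) (\<lambda>s'. \<exists>i' ys'.
    i' \<le> i \<and> vars s' ''i'' = int i' \<and> vars s' ''n'' = int (length ys') \<and>
    ys' @ select \<Delta> (\<lambda>i. f i - \<mu>) i' = ys @ select \<Delta> (\<lambda>i. f i - \<mu>) (Suc i) \<and>
    arrs s' a 0 = int d + int \<Delta> \<and> (\<forall>j<length ys'. arrs s' a (Suc j) = int (ys' ! j)))"
    (is "runs _ _ _ _ ?Q")
proof (rule runs_wp)
  let ?b = "best \<Delta> (\<lambda>i. f i - \<mu>)"
  let ?sel = "select \<Delta> (\<lambda>i. f i - \<mu>)"
  have b: "0 \<le> ?b i" "?b i \<le> int d * (M + L)" "0 \<le> ?b (Suc i)" "?b (Suc i) \<le> int d * (M + L)"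
    using best_bounds[OF \<mu>] i by auto
  have fits: "fits w (int i)" "fits w (1 + int i)" "fits w (1 + int i - int \<Delta>)"
    "fits w (int (length ys))" "fits w (int (length ys) + 1)" "fits w (?b i)" "fits w (?b (Suc i))"
    using i(2) n(2) b W_bounds unfolding fits_iff by linarith+
  have VV: "arrs s ''V'' i = ?b i" "arrs s ''V'' (Suc i) = ?b (Suc i)" using V i by auto
  have nat: "nat (1 + int i) = Suc i" "nat (int (length ys) + 1) = Suc (length ys)" by auto
  have D: "vars s ''Delta'' = int \<Delta>" using s by (simp add: ready_def)
  have rec: "?sel (Suc i) = (if ?b i < ?b (Suc i) then Suc i # ?sel (Suc i - \<Delta>) else ?sel i)"
  proof -
    have "i - (\<Delta> - 1) = Suc i - \<Delta>" using \<Delta> by simp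
    then show ?thesis by (simp add: select.simps(2))
  qed
  define Q where "Q = ?Q"
  have "wp w (select_body a) Q s"
  proof (cases "?b i < ?b (Suc i)")
    case False
    have "Q s'" if "vars s' ''i'' = int i" "vars s' ''n'' = int (length ys)" "arrs s' = arrs s" for s'
      using that False A unfolding Q_def
      by (intro exI[of _ i] exI[of _ ys]) (simp add: rec)
    with False show ?thesis
      using fits VV D i(1) n(1) b a by (simp add: select_body_def nat)
  next
    case True
    have "Q s'" if "vars s' ''i'' = int (Suc i - \<Delta>)" "vars s' ''n'' = int (length ys) + 1"
      "arrs s' a = (arrs s a)(Suc (length ys) := 1 + int i)" for s'
      using that True A \<Delta> unfolding Q_def
      by (intro exI[of _ "Suc i - \<Delta>"] exI[of _ "ys @ [Suc i]"])
        (auto simp: rec nth_append less_Suc_eq)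
    with True show ?thesis
      using fits VV D i(1) n(1) b a by (simp add: select_body_def nat)
  qed
  then show "wp w (select_body a) ?Q s" by (simp add: Q_def)
qed

lemma select_runs:
  assumes s: "ready \<mu> s" and \<mu>: "\<bar>\<mu>\<bar> \<le> L" and a: "a \<noteq> ''V''" "a \<noteq> ''c''"
    and V: "\<forall>j\<le>d. arrs s ''V'' j = best \<Delta> (\<lambda>i. f i - \<mu>) j"
  defines "xs \<equiv> select \<Delta> (\<lambda>i. f i - \<mu>) d"
  shows "runs w (select_com a) s (80 * d)
    (\<lambda>s'. stored d \<Delta> xs (arrs s' a) \<and> vars s' ''n'' = int (length xs))"
proof -
  let ?init = "Assign ''i'' (Var ''d'') ;; Assign ''n'' (Const 0) ;;
      Store a (Const 0) (Add (Var ''d'') (Var ''Delta''))"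
  let ?b = "Less (Const 0) (Var ''i'')"
  let ?fin = "Store a (Add (Var ''n'') (Const 1)) (Sub (Const 0) (Var ''Delta''))"
  \<comment> \<open>The fuel only bounds \<open>i\<close> from above, since one iteration may lower
    \<open>i\<close> by \<Delta>.\<close>
  let ?I = "\<lambda>n s. \<exists>i ys. i \<le> n \<and> i \<le> d \<and> vars s ''i'' = int i \<and> vars s ''n'' = int (length ys) \<and>
    ys @ select \<Delta> (\<lambda>i. f i - \<mu>) i = xs \<and>
    arrs s a 0 = int d + int \<Delta> \<and> (\<forall>j<length ys. arrs s a (Suc j) = int (ys ! j))"
  let ?R = "\<lambda>s. vars s ''n'' = int (length xs) \<and>
    arrs s a 0 = int d + int \<Delta> \<and> (\<forall>j<length xs. arrs s a (Suc j) = int (xs ! j))"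
  have len: "length xs \<le> d" unfolding xs_def by (rule optimal_length[OF optimal_select[OF \<Delta>]])
  have "fits w (int d + int \<Delta>)" using W_bounds unfolding fits_iff by linarith
  with s have "runs w ?init s (max_cost ?init) (?I d)"
    by (intro runs_wp) (auto simp: ready_def xs_def intro!: exI[of _ "[]"])
  then have "runs w (select_com a) s (max_cost ?init +
      ((d * (1 + bcost ?b + max_cost (select_body a)) + (1 + bcost ?b)) + max_cost ?fin))
    (\<lambda>s'. stored d \<Delta> xs (arrs s' a) \<and> vars s' ''n'' = int (length xs))"
    unfolding select_com_def
  proof (rule runs_Seq_mid)
    fix s1 assume I: "?I d s1" and ag: "agree ?init s s1"
    have s1: "ready \<mu> s1" using s ag by (rule ready_agree) (use a in simp_all)
    have V1: "arrs s1 ''V'' = arrs s ''V''" using ag a by (simp add: agree_def)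
    have "runs w (While ?b (select_body a)) s1
      (d * (1 + bcost ?b + max_cost (select_body a)) + (1 + bcost ?b)) ?R"
      using I
    proof (rule runs_While[where I = "?I" and N = d])
      fix n s' assume "?I n s'" and ag: "agree (select_body a) s1 s'"
      then obtain i ys where i: "i \<le> n" "i \<le> d" "vars s' ''i'' = int i"
        and ys: "vars s' ''n'' = int (length ys)" "ys @ select \<Delta> (\<lambda>i. f i - \<mu>) i = xs"
        and A: "arrs s' a 0 = int d + int \<Delta>" "\<forall>j<length ys. arrs s' a (Suc j) = int (ys ! j)"
        by blast
      have s': "ready \<mu> s'" using s1 ag by (rule ready_agree) (use a in \<open>simp_all add: select_body_def\<close>)
      have V': "\<forall>j\<le>d. arrs s' ''V'' j = best \<Delta> (\<lambda>i. f i - \<mu>) j"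
        using ag V V1 a by (simp add: agree_def select_body_def)
      have "fits w (int i)" using i W_bounds unfolding fits_iff by linarith
      then have safe: "bsafe w s' ?b" using i by simp
      show "bsafe w s' ?b \<and> (\<not> pbval s' ?b \<longrightarrow> ?R s') \<and>
          (pbval s' ?b \<longrightarrow>
            (\<exists>n'. n = Suc n' \<and> runs w (select_body a) s' (max_cost (select_body a)) (?I n')))"
      proof (cases i)
        case 0
        with safe i ys A show ?thesis by simp
      next
        case (Suc j)
        then obtain n' where n': "n = Suc n'" "j \<le> n'" using i by (cases n) auto
        have le: "length ys \<le> d" using len ys(2) by auto
        have "runs w (select_body a) s' (max_cost (select_body a)) (?I n')"
          by (rule runs_weaken[OF select_body_runs[OF s' \<mu> a(1) V' i(3)[unfolded Suc]
                i(2)[unfolded Suc] ys(1) le A] order_refl])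
            (use n' ys i Suc in fastforce)
        with safe i n' Suc show ?thesis by simp
      qed
    qed
    then show "runs w (While ?b (select_body a) ;; ?fin) s1
      ((d * (1 + bcost ?b + max_cost (select_body a)) + (1 + bcost ?b)) + max_cost ?fin)
      (\<lambda>s'. stored d \<Delta> xs (arrs s' a) \<and> vars s' ''n'' = int (length xs))"
    proof (rule runs_Seq_mid)
      fix s2 assume R: "?R s2" and ag: "agree (While ?b (select_body a)) s1 s2"
      have "ready \<mu> s2" using s1 ag by (rule ready_agree) (use a in \<open>simp_all add: select_body_def\<close>)
      moreover have "fits w (int (length xs))" "fits w (int (length xs) + 1)" "fits w (- int \<Delta>)"
        using len W_bounds unfolding fits_iff by linarith+
      moreover have "nat (int (length xs) + 1) = Suc (length xs)" by simp
      ultimately show "runs w ?fin s2 (max_cost ?fin)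
        (\<lambda>s'. stored d \<Delta> xs (arrs s' a) \<and> vars s' ''n'' = int (length xs))"
        using R by (intro runs_wp) (simp add: ready_def stored_def)
    qed
  qed
  then show ?thesis
    by (rule runs_weaken) (use d in \<open>simp_all add: select_body_def\<close>)
qed

text \<open>Which optimum the table yields is forgotten here: the later steps use only optimality
  and, at odd multipliers, the uniqueness of the size.\<close>

lemma solve_runs:
  assumes s: "ready \<mu> s" and \<mu>: "\<bar>\<mu>\<bar> \<le> L" and a: "a \<noteq> ''V''" "a \<noteq> ''c''"
  shows "runs w (solve_com a) s (160 * d) (\<lambda>s'. \<exists>xs. optimal \<Delta> d f \<mu> xs \<and>
    stored d \<Delta> xs (arrs s' a) \<and> vars s' ''n'' = int (length xs))"
proof -
  have "runs w (solve_com a) s (80 * d + 80 * d) (\<lambda>s'. \<exists>xs. optimal \<Delta> d f \<mu> xs \<and>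
    stored d \<Delta> xs (arrs s' a) \<and> vars s' ''n'' = int (length xs))"
    unfolding solve_com_def
  proof (rule runs_Seq_mid[OF dp_runs[OF s \<mu>]])
    fix s1 assume V: "\<forall>j\<le>d. arrs s1 ''V'' j = best \<Delta> (\<lambda>i. f i - \<mu>) j" and ag: "agree dp_com s s1"
    have "ready \<mu> s1" using s ag by (rule ready_agree) (simp_all add: dp_com_def dp_body_def)
    from select_runs[OF this \<mu> a V] show "runs w (select_com a) s1 (80 * d)
      (\<lambda>s'. \<exists>xs. optimal \<Delta> d f \<mu> xs \<and>
        stored d \<Delta> xs (arrs s' a) \<and> vars s' ''n'' = int (length xs))"
      by (rule runs_weaken) (use optimal_select[OF \<Delta>] in blast)+
  qed
  then show ?thesis by simp
qed

end

section \<open>Commands of the complete algorithm\<close>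

definition init_body :: com where
  "init_body =
     Assign ''i'' (Add (Var ''i'') (Const 1)) ;;
     Assign ''v'' (Elem ''x'' (Var ''i'')) ;;
     Assign ''v'' (Mul (Var ''v'') (Var ''v'')) ;;
     Cond (Less (Const 0) (Var ''v''))
       (Assign ''v'' (Mul (Const 2)
         (Add (Mul (Add (Var ''k'') (Const 1)) (Var ''v'')) (Const 1)))) Skip ;;
     Store ''c'' (Var ''i'') (Var ''v'') ;;
     Cond (Less (Var ''mx'') (Var ''v'')) (Assign ''mx'' (Var ''v'')) Skip"

definition init_com :: com where
  "init_com = (Assign ''i'' (Const 0) ;; Assign ''mx'' (Const 0)) ;;
     While (Less (Var ''i'') (Var ''d'')) init_body"

definition search_body :: com where
  "search_body =
     (Assign ''mid'' (Div (Add (Var ''lo'') (Var ''hi'')) (Const 2)) ;;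
      Assign ''lam'' (Add (Mul (Const 2) (Var ''mid'')) (Const 1))) ;;
     solve_com ''B'' ;;
     Cond (Less (Var ''n'') (Var ''k''))
       (Assign ''hi'' (Var ''mid'')) (Assign ''lo'' (Var ''mid''))"

text \<open>The search ends with neighbouring \<open>lo\<close> and \<open>hi = lo + 1\<close>. The
  tested multipliers \<open>2 * lo + 1\<close> and \<open>2 * hi + 1\<close> then enclose the single
  even number \<open>2 * hi\<close>.\<close>

definition search_com :: com where
  "search_com = While (Less (Add (Var ''lo'') (Const 1)) (Var ''hi'')) search_body"

text \<open>Searches the least cut of the exchange argument. Because of the sentinel at index 0,
  \<open>B\<close> at \<open>i + sh\<close> holds entry \<open>i + sh - 1\<close> of the long list
  and \<open>A\<close> at \<open>i + 1\<close> holds entry \<open>i\<close> of the short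
  one.\<close>

definition splice_com :: com where
  "splice_com = Assign ''i'' (Const 0) ;;
     While (Less (Elem ''B'' (Add (Var ''i'') (Var ''sh'')))
         (Add (Elem ''A'' (Add (Var ''i'') (Const 1))) (Var ''Delta'')))
       (Assign ''i'' (Add (Var ''i'') (Const 1)))"

definition output_body :: com where
  "output_body =
     Assign ''j'' (Add (Var ''j'') (Const 1)) ;;
     Cond (Less (Var ''i'') (Var ''j''))
       (Assign ''p'' (Elem ''B'' (Add (Var ''j'') (Var ''sh''))))
       (Assign ''p'' (Elem ''A'' (Var ''j''))) ;;
     Store ''xhat'' (Var ''p'') (Elem ''x'' (Var ''p''))"

definition output_com :: com where
  "output_com = Assign ''j'' (Const 0) ;; While (Less (Var ''j'') (Var ''k'')) output_body"

definition main_com :: com where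
  "main_com =
     init_com ;;
     (Assign ''lo'' (Sub (Sub (Const 0) (Mul (Var ''mx'') (Var ''k''))) (Const 1)) ;;
      Assign ''hi'' (Add (Var ''mx'') (Const 1)) ;;
      Assign ''lam'' (Add (Mul (Const 2) (Var ''lo'')) (Const 1))) ;;
     solve_com ''B'' ;;
     Cond (Less (Var ''n'') (Var ''k'')) Skip
       (search_com ;;
        Assign ''lam'' (Add (Mul (Const 2) (Var ''lo'')) (Const 1)) ;;
        solve_com ''B'' ;;
        (Assign ''sh'' (Sub (Var ''n'') (Var ''k'')) ;;
         Assign ''lam'' (Add (Mul (Const 2) (Var ''hi'')) (Const 1))) ;;
        solve_com ''A'' ;;
        splice_com ;;
        output_com)"

section \<open>Correctness of the complete algorithm\<close>

context problem
begin

lemma splice_runs: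
  assumes s: "ready \<mu> s" and xs: "chain \<Delta> d xs" and ys: "chain \<Delta> d ys"
    and len: "length xs \<le> k" "k \<le> length ys" and sh: "vars s ''sh'' = int sh" "sh = length ys - k"
    and A: "stored d \<Delta> xs (arrs s ''A'')" and B: "stored d \<Delta> ys (arrs s ''B'')"
  shows "runs w splice_com s (30 * d) (\<lambda>s'. \<exists>i. vars s' ''i'' = int i \<and> i \<le> length xs \<and>
    (i < length xs \<longrightarrow> 0 < i + sh \<longrightarrow> xs ! i + \<Delta> \<le> ys ! (i + sh - 1)) \<and>
    (\<forall>j<i. 0 < j + sh \<and> ys ! (j + sh - 1) < xs ! j + \<Delta>))"
    (is "runs _ _ _ _ ?Q")
proof -
  let ?b = "Less (Elem ''B'' (Add (Var ''i'') (Var ''sh'')))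
         (Add (Elem ''A'' (Add (Var ''i'') (Const 1))) (Var ''Delta''))"
  let ?c = "Assign ''i'' (Add (Var ''i'') (Const 1))"
  let ?I = "\<lambda>n s. \<exists>i. n = length xs - i \<and> vars s ''i'' = int i \<and> i \<le> length xs \<and>
    (\<forall>j<i. 0 < j + sh \<and> ys ! (j + sh - 1) < xs ! j + \<Delta>)"
  have lens: "length xs \<le> d" "length ys \<le> d" using xs ys \<Delta> by (auto intro: chain_length)
  have "runs w (Assign ''i'' (Const 0)) s (max_cost (Assign ''i'' (Const 0))) (?I (length xs))"
    by (rule runs_wp) simp
  then have "runs w splice_com s (max_cost (Assign ''i'' (Const 0)) +
      (length xs * (1 + bcost ?b + max_cost ?c) + (1 + bcost ?b))) ?Q"
    unfolding splice_com_def
  proof (rule runs_Seq_mid)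
    fix s1 assume I: "?I (length xs) s1" and ag1: "agree (Assign ''i'' (Const 0)) s s1"
    show "runs w (While ?b ?c) s1 (length xs * (1 + bcost ?b + max_cost ?c) + (1 + bcost ?b)) ?Q"
      using I
    proof (rule runs_While[where I = "?I" and N = "length xs"])
      fix n s' assume "?I n s'" and ag: "agree ?c s1 s'"
      then obtain i where i: "n = length xs - i" "vars s' ''i'' = int i" "i \<le> length xs"
        and least: "\<forall>j<i. 0 < j + sh \<and> ys ! (j + sh - 1) < xs ! j + \<Delta>" by blast
      have eqs: "vars s' ''sh'' = int sh" "vars s' ''Delta'' = int \<Delta>"
          "arrs s' ''A'' = arrs s ''A''" "arrs s' ''B'' = arrs s ''B''"
        using ag ag1 s sh by (simp_all add: agree_def ready_def)
      define a where "a = arrs s ''A'' (Suc i)"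
      define b where "b = arrs s ''B'' (i + sh)"
      have a: "a = (if i < length xs then int (xs ! i) else - int \<Delta>)"
        using A i by (auto simp: a_def stored_def)
      have b: "b = (if i + sh = 0 then int d + int \<Delta> else int (ys ! (i + sh - 1)))"
      proof (cases "i + sh")
        case 0
        then show ?thesis using B by (simp add: b_def stored_def)
      next
        case (Suc q)
        then have "q < length ys" using i(3) sh(2) len by linarith
        then show ?thesis using B Suc by (simp add: b_def stored_def)
      qed
      \<comment> \<open>The test is \<open>b < a + \<Delta>\<close>. Past the end of
        \<open>xs\<close> its right side is 0, and \<open>b\<close> is nonnegative; at
        \<open>i + sh = 0\<close> its left side is \<open>d + \<Delta>\<close>, and \<open>a\<close>
        is at most \<open>d\<close>.\<close>
      have ab: "- int \<Delta> \<le> a" "a \<le> int d" "0 \<le> b" "b \<le> int d + int \<Delta>"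
      proof -
        show "- int \<Delta> \<le> a" by (simp add: a)
        show "a \<le> int d" using chain_nth_bounds[OF xs, of i] by (simp add: a)
        show "0 \<le> b" by (simp add: b)
        have "ys ! (i + sh - 1) \<le> d" if "i + sh \<noteq> 0"
          using chain_nth_bounds[OF ys, of "i + sh - 1"] i(3) sh(2) len that by simp
        then show "b \<le> int d + int \<Delta>" by (auto simp: b)
      qed
      have "fits w (int i)" "fits w (int i + 1)" "fits w (int sh)" "fits w (int i + int sh)"
        "fits w a" "fits w b" "fits w (a + int \<Delta>)"
        using ab lens i(3) sh(2) W_bounds unfolding fits_iff by linarith+
      moreover have nat: "nat (int i + 1) = Suc i" "nat (int i + int sh) = i + sh" by simp_all
      ultimately have safe: "bsafe w s' ?b" and val: "pbval s' ?b \<longleftrightarrow> b < a + int \<Delta>"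
        and step: "safe w s' (Add (Var ''i'') (Const 1))"
        using i(2) eqs by (simp_all add: a_def b_def)
      show "bsafe w s' ?b \<and> (\<not> pbval s' ?b \<longrightarrow> ?Q s') \<and>
          (pbval s' ?b \<longrightarrow> (\<exists>n'. n = Suc n' \<and> runs w ?c s' (max_cost ?c) (?I n')))"
      proof (intro conjI impI)
        show "bsafe w s' ?b" by (rule safe)
        assume "\<not> pbval s' ?b"
        then have "a + int \<Delta> \<le> b" unfolding val by simp
        then have "i < length xs \<longrightarrow> 0 < i + sh \<longrightarrow> xs ! i + \<Delta> \<le> ys ! (i + sh - 1)"
          by (auto simp: a b)
        with i least show "?Q s'" by blast
      next
        assume "pbval s' ?b"
        then have lt: "b < a + int \<Delta>" unfolding val .
        then have less: "i < length xs" using ab by (cases "i < length xs") (auto simp: a)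
        have pos: "i + sh \<noteq> 0" using lt ab(2) b by (intro notI) simp
        have "b = int (ys ! (i + sh - 1))" "a = int (xs ! i)" using pos less by (simp_all only: a b if_True if_False)
        then have "ys ! (i + sh - 1) < xs ! i + \<Delta>" using lt by linarith
        with pos least have "\<forall>j<Suc i. 0 < j + sh \<and> ys ! (j + sh - 1) < xs ! j + \<Delta>"
          by (simp add: less_Suc_eq all_conj_distrib)
        with less have "?I (length xs - Suc i) (s'\<lparr>vars := (vars s')(''i'' := int (Suc i))\<rparr>)"
          by (intro exI[of _ "Suc i"]) simp
        then have "runs w ?c s' (max_cost ?c) (?I (length xs - Suc i))"
          using step i(2) by (intro runs_wp) (simp add: add.commute)
        with less i(1) show "\<exists>n'. n = Suc n' \<and> runs w ?c s' (max_cost ?c) (?I n')"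
          by (intro exI[of _ "length xs - Suc i"]) simp
      qed
    qed
  qed
  then show ?thesis by (rule runs_weaken) (use d lens in simp_all)
qed

lemma output_runs:
  assumes s: "ready \<mu> s" and xs: "chain \<Delta> d xs" and ys: "chain \<Delta> d ys"
    and len: "length xs \<le> k" "k \<le> length ys" and sh: "vars s ''sh'' = int sh" "sh = length ys - k"
    and A: "stored d \<Delta> xs (arrs s ''A'')" and B: "stored d \<Delta> ys (arrs s ''B'')"
    and i: "vars s ''i'' = int i" "i \<le> length xs"
    and x: "\<forall>j\<in>{1..d}. arrs s ''x'' j = m j" "\<forall>j\<in>{1..d}. \<bar>m j\<bar> \<le> M"
    and xhat: "arrs s ''xhat'' = (\<lambda>_. 0)"
  defines "us \<equiv> take i xs @ drop (i + sh) ys"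
  shows "runs w output_com s (30 * d) (\<lambda>s'. arrs s' ''xhat'' = (\<lambda>p. if p \<in> set us then m p else 0))"
    (is "runs _ _ _ _ ?Q")
proof -
  let ?b = "Less (Var ''j'') (Var ''k'')"
  let ?I = "\<lambda>n s. \<exists>j. n = k - j \<and> vars s ''j'' = int j \<and> j \<le> k \<and>
    arrs s ''xhat'' = (\<lambda>p. if p \<in> set (take j us) then m p else 0)"
  have lens: "length xs \<le> d" "length ys \<le> d" using xs ys \<Delta> by (auto intro: chain_length)
  have us_len: "length us = k" using i len sh(2) by (simp add: us_def)
  have us_nth: "us ! j = (if j < i then xs ! j else ys ! (j + sh))" if "j < k" for j
    using that i len sh(2) by (auto simp: us_def nth_append add.commute)
  have us_range: "us ! j \<in> {1..d}" if "j < k" for j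
    using us_nth[OF that] chain_nth_bounds[OF xs, of j] chain_nth_bounds[OF ys, of "j + sh"] that i len sh(2)
    by (auto split: if_splits)
  have "runs w (Assign ''j'' (Const 0)) s (max_cost (Assign ''j'' (Const 0))) (?I k)"
    by (rule runs_wp) (simp add: xhat)
  then have "runs w output_com s (max_cost (Assign ''j'' (Const 0)) +
      (k * (1 + bcost ?b + max_cost output_body) + (1 + bcost ?b))) ?Q"
    unfolding output_com_def
  proof (rule runs_Seq_mid)
    fix s1 assume I: "?I k s1" and ag1: "agree (Assign ''j'' (Const 0)) s s1"
    show "runs w (While ?b output_body) s1 (k * (1 + bcost ?b + max_cost output_body) + (1 + bcost ?b)) ?Q"
      using I
    proof (rule runs_While[where I = "?I" and N = k])
      fix n s' assume "?I n s'" and ag: "agree output_body s1 s'"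
      then obtain j where j: "n = k - j" "vars s' ''j'' = int j" "j \<le> k"
        and xh: "arrs s' ''xhat'' = (\<lambda>p. if p \<in> set (take j us) then m p else 0)" by blast
      have eqs: "vars s' ''sh'' = int sh" "vars s' ''k'' = int k" "vars s' ''i'' = int i"
          "arrs s' ''A'' = arrs s ''A''" "arrs s' ''B'' = arrs s ''B''" "arrs s' ''x'' = arrs s ''x''"
        using ag ag1 s sh i by (simp_all add: agree_def ready_def output_body_def)
      have fits: "fits w (int j)" "fits w (int j + 1)" "fits w (int sh)" "fits w (int j + 1 + int sh)"
        "fits w (int i)"
        using lens i(2) j(3) sh(2) len W_bounds unfolding fits_iff by linarith+
      show "bsafe w s' ?b \<and> (\<not> pbval s' ?b \<longrightarrow> ?Q s') \<and>
          (pbval s' ?b \<longrightarrow> (\<exists>n'. n = Suc n' \<and> runs w output_body s' (max_cost output_body) (?I n')))"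
      proof (intro conjI impI)
        show "bsafe w s' ?b" using fits j(2) eqs by simp
        assume "\<not> pbval s' ?b"
        then have "j = k" using j eqs by simp
        then show "?Q s'" using xh us_len by simp
      next
        assume "pbval s' ?b"
        then have jk: "j < k" using j eqs by simp
        define p where "p = us ! j"
        have p: "p \<in> {1..d}" "arrs s ''x'' p = m p" "- M \<le> m p" "m p \<le> M"
        proof -
          show "p \<in> {1..d}" using us_range[OF jk] by (simp add: p_def)
          with x have "\<bar>m p\<bar> \<le> M" "arrs s ''x'' p = m p" by blast+
          then show "arrs s ''x'' p = m p" "- M \<le> m p" "m p \<le> M" by linarith+
        qed
        have pf: "fits w (int p)" "fits w (m p)" using p(1,3,4) W_bounds unfolding fits_iff atLeastAtMost_iff by linarith+
        have BA: "arrs s ''B'' (Suc (j + sh)) = int p" if "i \<le> j"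
          using that B us_nth[OF jk] jk sh(2) len by (auto simp: stored_def p_def)
        have AB: "arrs s ''A'' (Suc j) = int p" if "j < i"
          using that A us_nth[OF jk] i(2) by (auto simp: stored_def p_def)
        have nat: "nat (int j + 1) = Suc j" "nat (int j + 1 + int sh) = Suc (j + sh)" by simp_all
        define Q :: "state \<Rightarrow> bool" where "Q = ?I (k - Suc j)"
        have tk: "set (take (Suc j) us) = insert p (set (take j us))"
          using jk us_len by (simp add: take_Suc_conv_app_nth p_def)
        have Q: "Q s''" if "vars s'' ''j'' = int j + 1" "arrs s'' ''xhat'' = (arrs s' ''xhat'')(p := m p)"
          for s'' using that jk unfolding Q_def
          by (intro exI[of _ "Suc j"]) (auto simp: xh tk fun_eq_iff)
        have "wp w output_body Q s'"
          using fits pf eqs j(2) BA AB p(2) Q by (simp add: output_body_def nat)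
        then have "runs w output_body s' (max_cost output_body) (?I (k - Suc j))"
          unfolding Q_def by (rule runs_wp)
        with jk j(1) show "\<exists>n'. n = Suc n' \<and> runs w output_body s' (max_cost output_body) (?I n')"
          by (intro exI[of _ "k - Suc j"]) simp
      qed
    qed
  qed
  then show ?thesis
  proof (rule runs_weaken)
    \<comment> \<open>The loop makes \<open>k\<close> rounds, and
      \<open>k \<le> length ys \<le> d\<close>.\<close>
    have "k * (1 + bcost ?b + max_cost output_body) \<le> d * (1 + bcost ?b + max_cost output_body)"
      using len lens by (intro mult_right_mono) auto
    then show "max_cost (Assign ''j'' (Const 0)) +
      (k * (1 + bcost ?b + max_cost output_body) + (1 + bcost ?b)) \<le> 30 * d"
      using d by (simp add: output_body_def)
  qed
qed

text \<open>Bounds for the intermediate values in the computation of a weight, all derived from the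
  bound on the weight itself; for integers the absolute value is at most the square.\<close>

lemma weights_bounds:
  assumes "f = weight k m" "j \<in> {1..d}"
  shows "\<bar>m j\<bar> \<le> M" "m j * m j \<le> M" "(int k + 1) * (m j * m j) + 1 \<le> M + 1"
proof -
  let ?v = "m j * m j"
  have 1: "0 \<le> ?v" "0 \<le> int k * ?v" by simp_all
  have "f j = 2 * (int k * ?v + ?v + (if m j = 0 then 0 else 1))"
    using assms(1) by (simp add: weight_def algebra_simps)
  then have 2: "2 * (int k * ?v) + 2 * ?v \<le> M" using f[OF assms(2)] by (auto split: if_splits)
  moreover have "(int k + 1) * ?v = int k * ?v + ?v" by (simp add: algebra_simps)
  ultimately show "?v \<le> M" "(int k + 1) * ?v + 1 \<le> M + 1" using 1 by linarith+
  have "\<bar>m j\<bar> \<le> ?v"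
  proof (cases "m j = 0")
    case False
    then have "\<bar>m j\<bar> * 1 \<le> \<bar>m j\<bar> * \<bar>m j\<bar>" by (intro mult_left_mono) auto
    then show ?thesis by simp
  qed simp
  with 1 2 show "\<bar>m j\<bar> \<le> M" by linarith
qed

lemma init_runs:
  assumes s: "vars s ''d'' = int d" "vars s ''k'' = int k" "vars s ''Delta'' = int \<Delta>"
    and m: "f = weight k m" and x: "\<forall>j\<in>{1..d}. arrs s ''x'' j = m j"
  shows "runs w init_com s (60 * d) (\<lambda>s'. (\<forall>j\<in>{1..d}. arrs s' ''c'' j = f j \<and> f j \<le> vars s' ''mx'') \<and>
    0 \<le> vars s' ''mx'' \<and> vars s' ''mx'' \<le> M)" (is "runs _ _ _ _ ?Q")
proof -
  let ?init = "Assign ''i'' (Const 0) ;; Assign ''mx'' (Const 0)"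
  let ?b = "Less (Var ''i'') (Var ''d'')"
  let ?I = "\<lambda>n s. \<exists>i. n = d - i \<and> i \<le> d \<and> vars s ''i'' = int i \<and>
    (\<forall>j\<in>{1..i}. arrs s ''c'' j = f j \<and> f j \<le> vars s ''mx'') \<and>
    0 \<le> vars s ''mx'' \<and> vars s ''mx'' \<le> M"
  have "runs w ?init s (max_cost ?init) (?I d)"
    by (rule runs_wp) (simp add: M)
  then have "runs w init_com s (max_cost ?init +
      (d * (1 + bcost ?b + max_cost init_body) + (1 + bcost ?b))) ?Q"
    unfolding init_com_def
  proof (rule runs_Seq_mid)
    fix s1 assume I: "?I d s1" and ag1: "agree ?init s s1"
    show "runs w (While ?b init_body) s1 (d * (1 + bcost ?b + max_cost init_body) + (1 + bcost ?b)) ?Q"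
      using I
    proof (rule runs_While[where I = "?I" and N = d])
      fix n s' assume "?I n s'" and ag: "agree init_body s1 s'"
      then obtain i where i: "n = d - i" "i \<le> d" "vars s' ''i'' = int i"
        and c: "\<forall>j\<in>{1..i}. arrs s' ''c'' j = f j \<and> f j \<le> vars s' ''mx''"
        and mx: "0 \<le> vars s' ''mx''" "vars s' ''mx'' \<le> M" by blast
      have eqs: "vars s' ''d'' = int d" "vars s' ''k'' = int k" "arrs s' ''x'' = arrs s ''x''"
        using ag ag1 s by (simp_all add: agree_def init_body_def)
      have fits: "fits w (int i)" "fits w (int i + 1)" "fits w (int k + 1)" "fits w (vars s' ''mx'')"
        using i mx W_bounds unfolding fits_iff by linarith+
      show "bsafe w s' ?b \<and> (\<not> pbval s' ?b \<longrightarrow> ?Q s') \<and>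
          (pbval s' ?b \<longrightarrow> (\<exists>n'. n = Suc n' \<and> runs w init_body s' (max_cost init_body) (?I n')))"
      proof (intro conjI[of "bsafe w s' ?b"] conjI[of "\<not> pbval s' ?b \<longrightarrow> ?Q s'"] impI)
        show "bsafe w s' ?b" using fits i(3) eqs by simp
        assume "\<not> pbval s' ?b"
        then have "i = d" using i eqs by simp
        then show "?Q s'" using c mx by simp
      next
        assume "pbval s' ?b"
        then have id: "i < d" using i eqs by simp
        define q where "q = m (Suc i)"
        define r where "r = q * q"
        have j: "Suc i \<in> {1..d}" using id by simp
        have x: "arrs s ''x'' (Suc i) = q" using x j by (simp add: q_def)
        have fi: "f (Suc i) = 2 * ((int k + 1) * r + (if r = 0 then 0 else 1))"
          using m by (simp add: weight_def q_def r_def)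
        have r: "0 \<le> r" "- M \<le> q" "q \<le> M" "r \<le> M" "(int k + 1) * r + 1 \<le> M + 1" "0 \<le> (int k + 1) * r"
          using weights_bounds[OF m j] by (simp_all add: q_def r_def abs_le_iff)
        have fr: "0 \<le> f (Suc i)" "f (Suc i) \<le> M" using f[OF j] by auto
        have fits2: "fits w q" "fits w r" "fits w ((int k + 1) * r)" "fits w ((int k + 1) * r + 1)"
          "fits w (f (Suc i))"
          using r fr W_bounds unfolding fits_iff by linarith+
        have nat: "nat (int i + 1) = Suc i" by simp
        define Q :: "state \<Rightarrow> bool" where "Q = ?I (d - Suc i)"
        have Q: "Q s''" if "vars s'' ''i'' = int i + 1"
          "arrs s'' ''c'' = (arrs s' ''c'')(Suc i := f (Suc i))"
          "vars s'' ''mx'' = max (vars s' ''mx'') (f (Suc i))" for s''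
          using that id c mx fr unfolding Q_def
          by (intro exI[of _ "Suc i"]) (auto simp: atLeastAtMostSuc_conv)
        have "wp w init_body Q s'"
        proof (cases "r = 0")
          case True
          then have "q = 0" "f (Suc i) = 0" by (simp_all add: r_def fi)
          then show ?thesis
            using fits eqs i(3) x Q mx by (simp add: init_body_def nat)
        next
          case False
          then have "0 < r" "f (Suc i) = 2 * ((int k + 1) * r + 1)" using r by (simp_all add: fi)
          then show ?thesis
            using fits fits2 eqs i(3) x Q by (simp add: init_body_def nat r_def[symmetric] max_def)
        qed
        then have "runs w init_body s' (max_cost init_body) (?I (d - Suc i))"
          unfolding Q_def by (rule runs_wp)
        with id i(1) show "\<exists>n'. n = Suc n' \<and> runs w init_body s' (max_cost init_body) (?I n')"
          by (intro exI[of _ "d - Suc i"]) simp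
      qed
    qed
  qed
  then show ?thesis by (rule runs_weaken) (use d in \<open>simp_all add: init_body_def\<close>)
qed

lemma wvars_solve: "wvars (solve_com a) = {''i'', ''u'', ''n''}" "warrs (solve_com a) = {''V'', a}"
  by (auto simp: solve_com_def dp_com_def dp_body_def select_com_def select_body_def)

text \<open>Quantifying over all optima makes the property independent of the list returned. Since
  the size is unique at odd multipliers, one run of the solver decides between
  \<open>long_at\<close> and \<open>short_at\<close>.\<close>

definition long_at :: "int \<Rightarrow> bool" where
  "long_at l \<longleftrightarrow> (\<forall>xs. optimal \<Delta> d f (2 * l + 1) xs \<longrightarrow> k \<le> length xs)"

definition short_at :: "int \<Rightarrow> bool" where
  "short_at h \<longleftrightarrow> (\<forall>xs. optimal \<Delta> d f (2 * h + 1) xs \<longrightarrow> length xs < k)"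

lemma search_body_runs:
  assumes s: "ready \<mu> s" and even: "\<And>i. even (f i)"
    and lh: "vars s ''lo'' = l" "vars s ''hi'' = h" "- (M * int k) - 1 \<le> l" "h \<le> M + 1" "l + 1 < h"
    and lo: "long_at l" and hi: "short_at h"
  shows "runs w search_body s (160 * d + 40) (\<lambda>s'.
    let mid = (l + h) div 2 in
      (vars s' ''lo'' = mid \<and> vars s' ''hi'' = h \<and> long_at mid) \<or>
      (vars s' ''lo'' = l \<and> vars s' ''hi'' = mid \<and> short_at mid))" (is "runs _ _ _ _ ?Q")
proof -
  define mid where "mid = (l + h) div 2"
  have mid: "l < mid" "mid < h" using lh(5) unfolding mid_def by linarith+
  let ?pre = "Assign ''mid'' (Div (Add (Var ''lo'') (Var ''hi'')) (Const 2)) ;;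
      Assign ''lam'' (Add (Mul (Const 2) (Var ''mid'')) (Const 1))"
  let ?post = "Cond (Less (Var ''n'') (Var ''k''))
       (Assign ''hi'' (Var ''mid'')) (Assign ''lo'' (Var ''mid''))"
  have "fits w l" "fits w h" "fits w (l + h)" "fits w mid" "fits w (2 * mid)" "fits w (2 * mid + 1)"
    using lh mid L W_bounds unfolding fits_iff by linarith+
  then have "runs w ?pre s (max_cost ?pre) (\<lambda>s'. vars s' ''mid'' = mid \<and> vars s' ''lam'' = 2 * mid + 1)"
    using lh by (intro runs_wp) (simp add: mid_def)
  then have "runs w search_body s (max_cost ?pre + (160 * d + max_cost ?post)) ?Q"
    unfolding search_body_def
  proof (rule runs_Seq_mid)
    fix s1 assume s1: "vars s1 ''mid'' = mid \<and> vars s1 ''lam'' = 2 * mid + 1" and ag: "agree ?pre s s1"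
    have r1: "ready (2 * mid + 1) s1" using s ag s1 by (simp add: agree_def ready_def)
    have "\<bar>2 * mid + 1\<bar> \<le> L" using lh mid L W_bounds by linarith
    then show "runs w (solve_com ''B'' ;; ?post) s1 (160 * d + max_cost ?post) ?Q"
    proof (rule runs_Seq_mid[OF solve_runs[OF r1]])
      fix s2 assume "\<exists>xs. optimal \<Delta> d f (2 * mid + 1) xs \<and>
        stored d \<Delta> xs (arrs s2 ''B'') \<and> vars s2 ''n'' = int (length xs)"
        and ag2: "agree (solve_com ''B'') s1 s2"
      then obtain xs where xs: "optimal \<Delta> d f (2 * mid + 1) xs" "vars s2 ''n'' = int (length xs)"
        by blast
      have uniq: "length ys = length xs" if "optimal \<Delta> d f (2 * mid + 1) ys" for ys
        using optimal_length_unique[OF even _ that xs(1)] by simp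
      have eqs: "vars s2 ''mid'' = mid" "vars s2 ''k'' = int k" "vars s2 ''lo'' = l" "vars s2 ''hi'' = h"
        using ag ag2 s1 s lh by (simp_all add: agree_def wvars_solve ready_def)
      have "fits w (int (length xs))"
        using optimal_length[OF xs(1)] W_bounds unfolding fits_iff by linarith
      moreover have "long_at mid" if "\<not> length xs < k" using that uniq by (auto simp: long_at_def)
      moreover have "short_at mid" if "length xs < k" using that uniq by (auto simp: short_at_def)
      ultimately show "runs w ?post s2 (max_cost ?post) ?Q"
        using eqs xs(2) \<open>fits w mid\<close> by (intro runs_wp) (simp add: mid_def[symmetric] Let_def)
    qed simp_all
  qed
  then show ?thesis by (rule runs_weaken) simp_all
qed

lemma search_runs:
  assumes s: "ready \<mu> s" and even: "\<And>i. even (f i)"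
    and lh: "vars s ''lo'' = l" "vars s ''hi'' = h" "- (M * int k) - 1 \<le> l" "h \<le> M + 1" "l < h"
    and lo: "long_at l" and hi: "short_at h" and N: "h - l \<le> 2 ^ N"
  shows "runs w search_com s (N * (160 * d + 50) + 10) (\<lambda>s'. \<exists>l. vars s' ''lo'' = l \<and> vars s' ''hi'' = l + 1 \<and>
    - (M * int k) - 1 \<le> l \<and> l \<le> M \<and> long_at l \<and> short_at (l + 1))" (is "runs _ _ _ _ ?Q")
proof -
  let ?b = "Less (Add (Var ''lo'') (Const 1)) (Var ''hi'')"
  let ?I = "\<lambda>n s. \<exists>l h. vars s ''lo'' = l \<and> vars s ''hi'' = h \<and>
    - (M * int k) - 1 \<le> l \<and> h \<le> M + 1 \<and> l < h \<and> long_at l \<and> short_at h \<and> h - l \<le> 2 ^ n"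
  have "?I N s" using assms by blast
  then have "runs w search_com s (N * (1 + bcost ?b + (160 * d + 40)) + (1 + bcost ?b)) ?Q"
    unfolding search_com_def
  proof (rule runs_While[where I = "?I" and N = N])
    fix n s' assume "?I n s'" and ag: "agree search_body s s'"
    then obtain l h where lh: "vars s' ''lo'' = l" "vars s' ''hi'' = h"
        "- (M * int k) - 1 \<le> l" "h \<le> M + 1"
      and less: "l < h" "h - l \<le> 2 ^ n" and P: "long_at l" "short_at h" by blast
    have s': "ready (vars s' ''lam'') s'"
      using s ag by (simp add: agree_def ready_def search_body_def wvars_solve)
    have "fits w l" "fits w h" "fits w (l + 1)" using lh less L W_bounds unfolding fits_iff by linarith+
    then have safe: "bsafe w s' ?b" using lh by simp
    have "\<exists>n'. n = Suc n' \<and> runs w search_body s' (160 * d + 40) (?I n')" if lt: "l + 1 < h"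
    proof -
      obtain n' where n: "n = Suc n'" using less lt by (cases n) auto
      \<comment> \<open>The midpoint is rounded down, so the upper half may be the longer one; it
        still has length at most \<open>2 ^ n'\<close> because the bound \<open>2 ^ Suc n'\<close>
        is even.\<close>
      have half: "h - (l + h) div 2 \<le> 2 ^ n'" "(l + h) div 2 - l \<le> 2 ^ n'"
        using less(2) unfolding n by simp_all
      have bt: "l < (l + h) div 2" "(l + h) div 2 < h" using lt by linarith+
      have "runs w search_body s' (160 * d + 40) (?I n')"
        by (rule runs_weaken[OF search_body_runs[OF s' even lh lt P] order_refl])
          (use half bt lh P in \<open>fastforce simp: Let_def\<close>)
      with n show ?thesis by blast
    qed
    moreover have "?Q s'" if "\<not> l + 1 < h"
    proof -
      have "h = l + 1" using that less by simp
      with lh P show ?thesis by auto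
    qed
    ultimately show "bsafe w s' ?b \<and> (\<not> pbval s' ?b \<longrightarrow> ?Q s') \<and>
        (pbval s' ?b \<longrightarrow> (\<exists>n'. n = Suc n' \<and> runs w search_body s' (160 * d + 40) (?I n')))"
      using safe lh by simp
  qed
  then show ?thesis by (rule runs_weaken) (simp_all add: algebra_simps)
qed

lemma wvars_parts:
  "wvars init_com = {''i'', ''mx'', ''v''}" "warrs init_com = {''c''}"
  "wvars search_com = {''mid'', ''lam'', ''i'', ''u'', ''n'', ''hi'', ''lo''}" "warrs search_com = {''V'', ''B''}"
  "wvars splice_com = {''i''}" "warrs splice_com = {}"
  by (auto simp: init_com_def init_body_def search_com_def search_body_def wvars_solve splice_com_def)

definition solves :: "(nat \<Rightarrow> int) \<Rightarrow> state \<Rightarrow> bool" where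
  "solves m s \<longleftrightarrow> (\<exists>us. chain \<Delta> d us \<and> length us = k \<and>
     (\<forall>zs. chain \<Delta> d zs \<longrightarrow> length zs = k \<longrightarrow> (\<Sum>z\<leftarrow>zs. f z) \<le> (\<Sum>u\<leftarrow>us. f u)) \<and>
     arrs s ''xhat'' = (\<lambda>p. if p \<in> set us then m p else 0))"

lemma finish_runs:
  assumes s: "ready \<mu> s" and even: "\<And>i. even (f i)" and m: "f = weight k m"
    and lh: "vars s ''lo'' = l" "vars s ''hi'' = l + 1" "- (M * int k) - 1 \<le> l" "l \<le> M"
    and lo: "long_at l" and hi: "short_at (l + 1)"
    and x: "\<forall>j\<in>{1..d}. arrs s ''x'' j = m j" and xhat: "arrs s ''xhat'' = (\<lambda>_. 0)"
  shows "runs w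
    (Assign ''lam'' (Add (Mul (Const 2) (Var ''lo'')) (Const 1)) ;;
     solve_com ''B'' ;;
     (Assign ''sh'' (Sub (Var ''n'') (Var ''k'')) ;;
      Assign ''lam'' (Add (Mul (Const 2) (Var ''hi'')) (Const 1))) ;;
     solve_com ''A'' ;;
     splice_com ;;
     output_com) s (400 * d) (solves m)"
proof -
  let ?c1 = "Assign ''lam'' (Add (Mul (Const 2) (Var ''lo'')) (Const 1))"
  let ?c2 = "Assign ''sh'' (Sub (Var ''n'') (Var ''k'')) ;;
      Assign ''lam'' (Add (Mul (Const 2) (Var ''hi'')) (Const 1))"
  have fits: "fits w l" "fits w (2 * l)" "fits w (2 * l + 1)"
    "fits w (l + 1)" "fits w (2 * (l + 1))" "fits w (2 * (l + 1) + 1)"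
    using lh(3,4) L W_bounds unfolding fits_iff distrib_left by linarith+
  have \<mu>: "\<bar>2 * l + 1\<bar> \<le> L" "\<bar>2 * (l + 1) + 1\<bar> \<le> L"
    using lh(3,4) L W_bounds unfolding distrib_left by linarith+
  have "runs w ?c1 s (max_cost ?c1) (\<lambda>s'. vars s' ''lam'' = 2 * l + 1)"
    using fits lh(1) by (intro runs_wp) simp
  then have "runs w (?c1 ;; solve_com ''B'' ;; ?c2 ;; solve_com ''A'' ;; splice_com ;; output_com) s
    (max_cost ?c1 + (160 * d + (max_cost ?c2 + (160 * d + (30 * d + 30 * d))))) (solves m)"
  proof (rule runs_Seq_mid)
    fix s1 assume s1: "vars s1 ''lam'' = 2 * l + 1" and ag1: "agree ?c1 s s1"
    have r1: "ready (2 * l + 1) s1" using s s1 ag1 by (simp add: ready_def agree_def)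
    show "runs w (solve_com ''B'' ;; ?c2 ;; solve_com ''A'' ;; splice_com ;; output_com) s1
      (160 * d + (max_cost ?c2 + (160 * d + (30 * d + 30 * d)))) (solves m)"
    proof (rule runs_Seq_mid[OF solve_runs[OF r1 \<mu>(1)]])
      fix s2 assume "\<exists>xs. optimal \<Delta> d f (2 * l + 1) xs \<and>
        stored d \<Delta> xs (arrs s2 ''B'') \<and> vars s2 ''n'' = int (length xs)"
        and ag2: "agree (solve_com ''B'') s1 s2"
      then obtain ys where ys: "optimal \<Delta> d f (2 * l + 1) ys" and B: "stored d \<Delta> ys (arrs s2 ''B'')"
        and n: "vars s2 ''n'' = int (length ys)" by blast
      have r2: "ready (2 * l + 1) s2" using r1 ag2 by (rule ready_agree) (simp_all add: wvars_solve)
      have ysk: "k \<le> length ys" "length ys \<le> d" using lo ys optimal_length by (auto simp: long_at_def)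
      define sh where "sh = length ys - k"
      have hi2: "vars s2 ''hi'' = l + 1" using ag1 ag2 lh by (simp add: agree_def wvars_solve)
      have "fits w (int (length ys))" "fits w (int (length ys) - int k)"
        using ysk W_bounds unfolding fits_iff by linarith+
      then have "runs w ?c2 s2 (max_cost ?c2)
          (\<lambda>s'. vars s' ''sh'' = int sh \<and> vars s' ''lam'' = 2 * (l + 1) + 1)"
        using r2 n fits ysk hi2 by (intro runs_wp) (simp add: ready_def sh_def of_nat_diff)
      then show "runs w (?c2 ;; solve_com ''A'' ;; splice_com ;; output_com) s2
        (max_cost ?c2 + (160 * d + (30 * d + 30 * d))) (solves m)"
      proof (rule runs_Seq_mid)
        fix s3 assume s3: "vars s3 ''sh'' = int sh \<and> vars s3 ''lam'' = 2 * (l + 1) + 1"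
          and ag3: "agree ?c2 s2 s3"
        have r3: "ready (2 * (l + 1) + 1) s3" using r2 s3 ag3 by (simp add: ready_def agree_def)
        show "runs w (solve_com ''A'' ;; splice_com ;; output_com) s3
          (160 * d + (30 * d + 30 * d)) (solves m)"
        proof (rule runs_Seq_mid[OF solve_runs[OF r3 \<mu>(2)]])
          fix s4 assume "\<exists>xs. optimal \<Delta> d f (2 * (l + 1) + 1) xs \<and>
            stored d \<Delta> xs (arrs s4 ''A'') \<and> vars s4 ''n'' = int (length xs)"
            and ag4: "agree (solve_com ''A'') s3 s4"
          then obtain xs where xs: "optimal \<Delta> d f (2 * (l + 1) + 1) xs"
            and A: "stored d \<Delta> xs (arrs s4 ''A'')" by blast
          have r4: "ready (2 * (l + 1) + 1) s4"
            using r3 ag4 by (rule ready_agree) (simp_all add: wvars_solve)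
          have xsk: "length xs \<le> k" using hi xs by (auto simp: short_at_def)
          have B4: "stored d \<Delta> ys (arrs s4 ''B'')" and sh4: "vars s4 ''sh'' = int sh"
            using B s3 ag3 ag4 by (simp_all add: agree_def wvars_solve)
          have x4: "arrs s4 ''x'' = arrs s ''x''" "arrs s4 ''xhat'' = arrs s ''xhat''"
            using ag1 ag2 ag3 ag4 by (simp_all add: agree_def wvars_solve)
          note chains = optimal_chain[OF xs] optimal_chain[OF ys]
          show "runs w (splice_com ;; output_com) s4 (30 * d + 30 * d) (solves m)"
          proof (rule runs_Seq_mid[OF splice_runs[OF r4 chains xsk ysk(1) sh4 sh_def A B4]])
            fix s5 assume "\<exists>i. vars s5 ''i'' = int i \<and> i \<le> length xs \<and>
              (i < length xs \<longrightarrow> 0 < i + sh \<longrightarrow> xs ! i + \<Delta> \<le> ys ! (i + sh - 1)) \<and>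
              (\<forall>j<i. 0 < j + sh \<and> ys ! (j + sh - 1) < xs ! j + \<Delta>)"
              and ag5: "agree splice_com s4 s5"
            then obtain i where i: "vars s5 ''i'' = int i" "i \<le> length xs"
              and link: "i < length xs \<Longrightarrow> 0 < i + sh \<Longrightarrow> xs ! i + \<Delta> \<le> ys ! (i + sh - 1)"
              and least: "\<And>j. j < i \<Longrightarrow> 0 < j + sh \<and> ys ! (j + sh - 1) < xs ! j + \<Delta>" by blast
            have r5: "ready (2 * (l + 1) + 1) s5"
              using r4 ag5 by (rule ready_agree) (simp_all add: wvars_parts)
            have eqs: "arrs s5 ''A'' = arrs s4 ''A''" "arrs s5 ''B'' = arrs s4 ''B''"
              "arrs s5 ''x'' = arrs s ''x''" "arrs s5 ''xhat'' = (\<lambda>_. 0)" "vars s5 ''sh'' = int sh"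
              using ag5 x4 sh4 xhat by (simp_all add: agree_def wvars_parts)
            have x5: "\<forall>j\<in>{1..d}. arrs s5 ''x'' j = m j" using x eqs by simp
            have m5: "\<forall>j\<in>{1..d}. \<bar>m j\<bar> \<le> M" using weights_bounds[OF m] by blast
            \<comment> \<open>The even multiplier of the exchange is \<open>2 * (l + 1)\<close>:
              \<open>ys\<close> belongs to the odd number below it and \<open>xs\<close> to the one
              above.\<close>
            have opt: "optimal \<Delta> d f (2 * (l + 1) + 1) xs" "optimal \<Delta> d f (2 * (l + 1) - 1) ys"
              using xs ys by (simp_all add: algebra_simps)
            note us = optimal_exchange[OF even _ opt xsk ysk(1) sh_def i(2) link least]
            show "runs w output_com s5 (30 * d) (solves m)"
              by (rule runs_weaken[OF output_runs[OF r5 chains xsk ysk(1) eqs(5) sh_def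
                    A[folded eqs(1)] B4[folded eqs(2)] i x5 m5 eqs(4)] order_refl])
                (use us in \<open>auto simp: solves_def\<close>)
          qed
        qed simp_all
      qed
    qed simp_all
  qed
  then show ?thesis by (rule runs_weaken) (use d in simp_all)
qed

lemma main_runs:
  assumes s: "vars s ''d'' = int d" "vars s ''k'' = int k" "vars s ''Delta'' = int \<Delta>"
    and even: "\<And>i. even (f i)" and m: "f = weight k m"
    and x: "\<forall>j\<in>{1..d}. arrs s ''x'' j = m j" and xhat: "arrs s ''xhat'' = (\<lambda>_. 0)"
    and N: "M * int k + M + 2 \<le> 2 ^ N"
  shows "runs w main_com s ((N + 4) * (220 * d))
    (\<lambda>s'. (\<exists>zs. chain \<Delta> d zs \<and> length zs = k) \<longrightarrow> solves m s')" (is "runs _ _ _ _ ?Q")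
proof -
  let ?c1 = "Assign ''lo'' (Sub (Sub (Const 0) (Mul (Var ''mx'') (Var ''k''))) (Const 1)) ;;
      Assign ''hi'' (Add (Var ''mx'') (Const 1)) ;;
      Assign ''lam'' (Add (Mul (Const 2) (Var ''lo'')) (Const 1))"
  let ?fin = "Assign ''lam'' (Add (Mul (Const 2) (Var ''lo'')) (Const 1)) ;;
     solve_com ''B'' ;;
     (Assign ''sh'' (Sub (Var ''n'') (Var ''k'')) ;;
      Assign ''lam'' (Add (Mul (Const 2) (Var ''hi'')) (Const 1))) ;;
     solve_com ''A'' ;;
     splice_com ;;
     output_com"
  let ?b = "Less (Var ''n'') (Var ''k'')"
  let ?T = "(N * (160 * d + 50) + 10) + 400 * d"
  have "runs w main_com s (60 * d + (max_cost ?c1 + (160 * d + (1 + bcost ?b + ?T)))) ?Q"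
    unfolding main_com_def
  proof (rule runs_Seq_mid[OF init_runs[OF s m x]])
    fix s1 assume s1: "(\<forall>j\<in>{1..d}. arrs s1 ''c'' j = f j \<and> f j \<le> vars s1 ''mx'') \<and>
      0 \<le> vars s1 ''mx'' \<and> vars s1 ''mx'' \<le> M" and ag1: "agree init_com s s1"
    define mx where "mx = vars s1 ''mx''"
    have mx: "0 \<le> mx" "mx \<le> M" "\<And>j. j \<in> {1..d} \<Longrightarrow> 0 \<le> f j \<and> f j \<le> mx"
      using s1 f by (auto simp: mx_def)
    define l where "l = - (mx * int k) - 1"
    have mk: "0 \<le> mx * int k" "mx * int k \<le> M * int k" using mx by (auto intro: mult_right_mono)
    have eqs1: "vars s1 ''k'' = int k" "vars s1 ''d'' = int d" "vars s1 ''Delta'' = int \<Delta>"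
      using ag1 s by (simp_all add: agree_def wvars_parts)
    have fits: "fits w mx" "fits w (mx * int k)" "fits w (- (mx * int k))" "fits w l" "fits w (mx + 1)"
      "fits w (2 * l)" "fits w (2 * l + 1)"
      using mk mx(1,2) L W_bounds l_def unfolding fits_iff by linarith+
    have \<mu>: "\<bar>2 * l + 1\<bar> \<le> L" using mk mx(1,2) L W_bounds l_def by linarith
    have "runs w ?c1 s1 (max_cost ?c1)
        (\<lambda>s'. vars s' ''lo'' = l \<and> vars s' ''hi'' = mx + 1 \<and> vars s' ''lam'' = 2 * l + 1)"
      using fits eqs1 by (intro runs_wp) (simp add: mx_def[symmetric] l_def)
    then show "runs w (?c1 ;; solve_com ''B'' ;; Cond ?b Skip (search_com ;; ?fin)) s1
      (max_cost ?c1 + (160 * d + (1 + bcost ?b + ?T))) ?Q"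
    proof (rule runs_Seq_mid)
      fix s2 assume s2: "vars s2 ''lo'' = l \<and> vars s2 ''hi'' = mx + 1 \<and> vars s2 ''lam'' = 2 * l + 1"
        and ag2: "agree ?c1 s1 s2"
      have r2: "ready (2 * l + 1) s2" using s1 s2 ag2 eqs1 by (simp add: ready_def agree_def)
      show "runs w (solve_com ''B'' ;; Cond ?b Skip (search_com ;; ?fin)) s2
        (160 * d + (1 + bcost ?b + ?T)) ?Q"
      proof (rule runs_Seq_mid[OF solve_runs[OF r2 \<mu>]])
        fix s3 assume "\<exists>xs. optimal \<Delta> d f (2 * l + 1) xs \<and>
          stored d \<Delta> xs (arrs s3 ''B'') \<and> vars s3 ''n'' = int (length xs)"
          and ag3: "agree (solve_com ''B'') s2 s3"
        then obtain xs where xs: "optimal \<Delta> d f (2 * l + 1) xs" "vars s3 ''n'' = int (length xs)"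
          by blast
        have r3: "ready (2 * l + 1) s3" using r2 ag3 by (rule ready_agree) (simp_all add: wvars_solve)
        have "fits w (int (length xs))"
          using optimal_length[OF xs(1)] W_bounds unfolding fits_iff by linarith
        then have b: "bval w s3 ?b = Some (length xs < k)"
          using xs(2) r3 by (subst bval_bsafe) (simp_all add: ready_def)
        show "runs w (Cond ?b Skip (search_com ;; ?fin)) s3 (1 + bcost ?b + ?T) ?Q"
        proof (rule runs_Cond[OF b])
          assume short: "length xs < k"
          \<comment> \<open>The multiplier is \<open>- 2 * mx * k - 1\<close>, low enough for a
            short optimum to prove infeasibility.\<close>
          have "2 * l + 1 < - (mx * int k)" using mk by (simp add: l_def)
          from optimal_small_multiplier[OF mx(3) this xs(1)] short
          have "\<not> (\<exists>zs. chain \<Delta> d zs \<and> length zs = k)" by fastforce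
          then have "?Q s3" by blast
          then have "runs w Skip s3 (max_cost Skip) ?Q" by (intro runs_wp) simp
          then show "runs w Skip s3 ?T ?Q" by (rule runs_weaken) simp_all
        next
          assume "\<not> length xs < k"
          then have lo: "long_at l"
            using optimal_length_unique[OF even _ _ xs(1)] by (auto simp: long_at_def)
          \<comment> \<open>The multiplier \<open>2 * mx + 3\<close> exceeds every weight, so the
            optimum is empty, and \<open>0 < k\<close>.\<close>
          have hi: "short_at (mx + 1)"
            using optimal_large_multiplier[of d f mx "2 * (mx + 1) + 1" \<Delta>] mx k
            by (fastforce simp: short_at_def)
          have lh: "vars s3 ''lo'' = l" "vars s3 ''hi'' = mx + 1" "- (M * int k) - 1 \<le> l"
              "mx + 1 \<le> M + 1" "l < mx + 1" "mx + 1 - l \<le> 2 ^ N"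
          proof -
            show "vars s3 ''lo'' = l" "vars s3 ''hi'' = mx + 1"
              using s2 ag3 by (simp_all add: agree_def wvars_solve)
            show "- (M * int k) - 1 \<le> l" "mx + 1 \<le> M + 1" "l < mx + 1" "mx + 1 - l \<le> 2 ^ N"
              using mk mx(1,2) N l_def by linarith+
          qed
          show "runs w (search_com ;; ?fin) s3 ?T ?Q"
          proof (rule runs_Seq_mid[OF search_runs[OF r3 even lh(1-5) lo hi lh(6)]])
            fix s4 assume "\<exists>l. vars s4 ''lo'' = l \<and> vars s4 ''hi'' = l + 1 \<and>
              - (M * int k) - 1 \<le> l \<and> l \<le> M \<and> long_at l \<and> short_at (l + 1)"
              and ag4: "agree search_com s3 s4"
            then obtain l' where l': "vars s4 ''lo'' = l'" "vars s4 ''hi'' = l' + 1"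
              "- (M * int k) - 1 \<le> l'" "l' \<le> M" "long_at l'" "short_at (l' + 1)" by blast
            have r4: "ready (vars s4 ''lam'') s4"
              using r3 ag4 by (simp add: ready_def agree_def wvars_parts)
            have x4: "\<forall>j\<in>{1..d}. arrs s4 ''x'' j = m j" "arrs s4 ''xhat'' = (\<lambda>_. 0)"
              using ag1 ag2 ag3 ag4 x xhat by (simp_all add: agree_def wvars_solve wvars_parts)
            show "runs w ?fin s4 (400 * d) ?Q"
              by (rule runs_weaken[OF finish_runs[OF r4 even m l' x4] order_refl]) simp
          qed
        qed
      qed simp_all
    qed
  qed
  then show ?thesis
  proof (rule runs_weaken)
    \<comment> \<open>Since \<open>d \<ge> 1\<close>, constants are absorbed into multiples of
      \<open>d\<close>: one bisection step costs at most \<open>210 * d\<close>, and the remaining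
      \<open>60 + 160 + 400\<close> times \<open>d\<close> with its constants stays below
      \<open>4 * 220 * d\<close>.\<close>
    have "N * (160 * d + 50) \<le> N * (220 * d)" using d by (intro mult_left_mono) auto
    moreover have "(N + 4) * (220 * d) = N * (220 * d) + 880 * d" by (simp add: distrib_right)
    moreover have "max_cost ?c1 + (1 + bcost ?b) \<le> 40" by simp
    ultimately show "60 * d + (max_cost ?c1 + (160 * d + (1 + bcost ?b + ?T))) \<le> (N + 4) * (220 * d)"
      using d by linarith
  qed
qed

end

section \<open>Resource bounds\<close>

text \<open>With \<open>k + 1 \<le> 2 ^ (bits k - 1)\<close> and coefficients of size at most
  \<open>2 ^ (\<gamma> - 1)\<close>, the product of \<open>k + 1\<close> and a squared coefficient
  is at most \<open>M / 8\<close>. Adding 1 and doubling stays below \<open>M\<close>. The second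
  claim bounds the length of the search interval and so gives the number of bisection steps.\<close>

lemma problem_weight:
  assumes d: "1 \<le> d" and k: "1 \<le> k" and \<Delta>: "1 \<le> \<Delta>" and \<gamma>: "\<gamma> = max_bits d m"
  defines "M \<equiv> 2 ^ (bits (int k) + 2 * \<gamma>)"
  shows "problem (word_size 10 d k \<Delta> \<gamma>) d k \<Delta> (weight k m) (2 ^ word_size 10 d k \<Delta> \<gamma>) M
      (2 * (M * int k) + 2 * M + 3)"
    and "M * int k + M + 2 \<le> 2 ^ (2 * bits (int k) + 2 * \<gamma>)" and "1 \<le> \<gamma>"
proof -
  let ?K = "bits (int k)"
  have mb: "bits (m i) \<le> \<gamma>" if "i \<in> {1..d}" for i
    unfolding \<gamma> max_bits_def using that by (intro Max_ge) auto
  show \<gamma>1: "1 \<le> \<gamma>" using mb[of 1] bits_bounds(1)[of "m 1"] d by simp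
  have k2: "int k + 1 \<le> 2 ^ (?K - 1)" using bits_bounds(3)[of "int k"] by linarith
  have K: "2 \<le> ?K"
  proof (rule ccontr)
    assume "\<not> 2 \<le> ?K"
    then have "?K - 1 = 0" by simp
    with k2 k show False by simp
  qed
  have M0: "0 < M" by (simp add: M_def)
  have f: "0 \<le> weight k m i \<and> weight k m i \<le> M" if i: "i \<in> {1..d}" for i
  proof -
    have "\<bar>m i\<bar> \<le> 2 ^ (bits (m i) - 1)" by (rule bits_bounds)
    also have "\<dots> \<le> 2 ^ (\<gamma> - 1)" using mb[OF i] by (intro power_increasing) auto
    finally have "\<bar>m i\<bar> * \<bar>m i\<bar> \<le> 2 ^ (\<gamma> - 1) * 2 ^ (\<gamma> - 1)" by (intro mult_mono) auto
    then have "m i * m i \<le> 2 ^ (\<gamma> - 1) * 2 ^ (\<gamma> - 1)" by simp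
    then have "(int k + 1) * (m i * m i) \<le> 2 ^ (?K - 1) * (2 ^ (\<gamma> - 1) * 2 ^ (\<gamma> - 1))"
      by (rule mult_mono[OF k2]) simp_all
    then have "(int k + 1) * (m i * m i) \<le> 2 ^ (?K + 2 * \<gamma> - 3)"
      using K \<gamma>1 by (simp flip: power_add add: numeral_eq_Suc)
    moreover have "M = 8 * 2 ^ (?K + 2 * \<gamma> - 3)"
    proof -
      have "M = 2 ^ (3 + (?K + 2 * \<gamma> - 3))" unfolding M_def using K \<gamma>1 by simp
      then show ?thesis by (simp only: power_add) simp
    qed
    moreover have "(1 :: int) \<le> 2 ^ (?K + 2 * \<gamma> - 3)" by simp
    moreover have "0 \<le> (int k + 1) * (m i * m i)" by simp
    ultimately show ?thesis unfolding weight_def by (simp only: distrib_left split: if_split) linarith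
  qed
  have "M * (int k + 1) \<le> M * 2 ^ (?K - 1)" using k2 M0 by (intro mult_left_mono) auto
  also have "\<dots> = 2 ^ (2 * ?K + 2 * \<gamma> - 1)"
    unfolding M_def using K by (simp flip: power_add add: mult_2)
  finally have "M * (int k + 1) \<le> 2 ^ (2 * ?K + 2 * \<gamma> - 1)" .
  moreover have "(2 :: int) ^ (2 * ?K + 2 * \<gamma>) = 2 * 2 ^ (2 * ?K + 2 * \<gamma> - 1)"
    using K by (cases "2 * ?K + 2 * \<gamma>") auto
  ultimately have 1: "2 * (M * (int k + 1)) \<le> 2 ^ (2 * ?K + 2 * \<gamma>)" by linarith
  have "(2 :: int) ^ 2 \<le> M" unfolding M_def using K by (intro power_increasing) auto
  then have "4 \<le> M" by simp
  moreover have "0 \<le> M * int k" using M0 by simp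
  moreover have "M * (int k + 1) = M * int k + M" by (simp add: distrib_left)
  ultimately show N: "M * int k + M + 2 \<le> 2 ^ (2 * ?K + 2 * \<gamma>)"
    using 1 by linarith
  \<comment> \<open>One power of two for each of \<open>d\<close>, the multipliers and \<Delta>. The
    exponent of \<open>Q\<close> has one bit more than that of the search interval because
    multipliers are about twice the search index.\<close>
  define P Q R :: int where "P = 2 ^ bits (int d)" and "Q = 2 ^ (2 * ?K + 2 * \<gamma> + 1)"
    and "R = 2 ^ bits (int \<Delta>)"
  have pos: "1 \<le> P" "1 \<le> Q" "1 \<le> R" unfolding P_def Q_def R_def by (rule one_le_power, simp)+
  have less_pow: "n \<le> 2 ^ bits n" for n :: int
  proof -
    have "(2 :: int) ^ (bits n - 1) \<le> 2 ^ bits n" by (intro power_increasing) auto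
    with bits_bounds(3)[of n] show ?thesis by linarith
  qed
  have dP: "int d \<le> P" and \<Delta>R: "int \<Delta> \<le> R" by (simp_all add: P_def R_def less_pow)
  define L where "L = 2 * (M * int k) + 2 * M + 3"
  have L: "M + L \<le> 2 * Q" "L \<le> Q" "0 \<le> L" "M \<le> Q" "int k \<le> Q"
  proof -
    have Q: "Q = 2 * 2 ^ (2 * ?K + 2 * \<gamma>)" by (simp add: Q_def)
    have mk: "0 \<le> M * int k" "int k \<le> M * int k" using M0 mult_right_mono[of 1 M "int k"] by auto
    show "L \<le> Q" "0 \<le> L" "M \<le> Q" "int k \<le> Q" using N mk M0 unfolding Q L_def by linarith+
    then show "M + L \<le> 2 * Q" by linarith
  qed
  let ?X = "P * Q * R"
  have X: "P \<le> ?X" "Q \<le> ?X" "R \<le> ?X" "P * Q \<le> ?X" "1 \<le> ?X"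
  proof -
    have *: "a \<le> a * b" "1 \<le> a * b" if "1 \<le> a" "1 \<le> b" for a b :: int
    proof -
      have "a * 1 \<le> a * b" using that by (intro mult_left_mono) auto
      with that show "a \<le> a * b" "1 \<le> a * b" by linarith+
    qed
    have PQ: "1 \<le> P * Q" "P \<le> P * Q" "Q \<le> P * Q"
      using *[OF pos(1,2)] *(1)[OF pos(2,1)] by (simp_all add: mult.commute)
    show "P * Q \<le> ?X" "1 \<le> ?X" using *[OF PQ(1) pos(3)] by simp_all
    then show "P \<le> ?X" "Q \<le> ?X" using PQ by linarith+
    show "R \<le> ?X" using *(1)[OF pos(3) PQ(1)] by (simp add: mult.commute)
  qed
  have "int d * (M + L) \<le> P * (2 * Q)" using dP L M0 by (intro mult_mono) auto
  \<comment> \<open>Every summand is a multiple of at most \<open>P * Q * R\<close>; the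
    coefficients add up to 19, rounded up to the power 32. The resulting exponent has coefficients
    at most 2 and an additive constant 6, which the word factor 10 covers.\<close>
  then have "int d * (M + L) + M + 4 * L + 4 * int d + 2 * int k + 2 * int \<Delta> + 4 \<le> 32 * ?X"
    using X L dP \<Delta>R by linarith
  also have "32 * ?X = 2 ^ (5 + bits (int d) + (2 * ?K + 2 * \<gamma> + 1) + bits (int \<Delta>))"
    by (simp add: P_def Q_def R_def power_add)
  also have "\<dots> < 2 ^ word_size 10 d k \<Delta> \<gamma>"
    using \<gamma>1 K by (intro power_strict_increasing) (auto simp: word_size_def)
  finally show "problem (word_size 10 d k \<Delta> \<gamma>) d k \<Delta> (weight k m) (2 ^ word_size 10 d k \<Delta> \<gamma>) M
      (2 * (M * int k) + 2 * M + 3)"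
    using d k \<Delta> f M0 unfolding L_def by unfold_locales auto
qed

text \<open>As \<gamma> \<ge> 1, the constants 4 (from twice \<open>bits_le_log\<close>) and 4 add
  at most \<open>8 * \<gamma>\<close>, so the first factor is at most
  \<open>10 * (\<gamma> + log k)\<close>; 2200 is 10 times 220. Both \<open>lg\<close> factors are
  at least 1.\<close>

lemma time_bound:
  assumes "1 \<le> k" "1 \<le> \<gamma>"
    and t: "t \<le> (2 * bits (int k) + 2 * \<gamma> + 4) * (220 * d)"
  shows "real t \<le> 2200 * (real d * (real \<gamma> + log 2 (real k)) * lg d * lg \<Delta>)"
proof -
  have nn: "0 \<le> log 2 (real k)" using assms(1) by simp
  have "real t \<le> real ((2 * bits (int k) + 2 * \<gamma> + 4) * (220 * d))" using t of_nat_mono by blast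
  also have "\<dots> = (2 * real (bits (int k)) + 2 * real \<gamma> + 4) * (220 * real d)" by simp
  also have "\<dots> \<le> (10 * (real \<gamma> + log 2 (real k))) * (220 * real d)"
    using bits_le_log[OF assms(1)] assms(2) nn by (intro mult_right_mono) auto
  also have "\<dots> = 2200 * (real d * (real \<gamma> + log 2 (real k)))" by simp
  also have "\<dots> \<le> 2200 * (real d * (real \<gamma> + log 2 (real k)) * lg d * lg \<Delta>)"
  proof -
    let ?a = "real d * (real \<gamma> + log 2 (real k))"
    have a: "0 \<le> ?a" using nn by simp
    have "1 * 1 \<le> lg d * lg \<Delta>" by (intro mult_mono) (auto simp: lg_def)
    from mult_left_mono[OF this a] show ?thesis by (simp add: mult.assoc)
  qed
  finally show ?thesis .
qed

text \<open>A single run serves both readings of the support constraint. Each claim is conditional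
  on a minimizer: none exists if there is no separated \<open>k\<close>-set, and for supports of
  exact size \<open>k\<close> the infimum may also fail to be attained.\<close>

theorem theorem2:
  "\<exists>(prog :: com) (c :: nat) (C :: real).
     \<forall>(d :: nat) (k :: nat) (\<Delta> :: nat) (\<gamma> :: nat) (x :: nat \<Rightarrow> real) (m :: nat \<Rightarrow> int) (e :: int).
       d \<ge> 1 \<and> k \<ge> 1 \<and> \<Delta> \<ge> 1 \<and> (\<forall>i\<in>{1..d}. x i = decode e m i) \<and> \<gamma> = max_bits d m \<longrightarrow>
       (\<exists>t s xhat.
          exec (word_size c d k \<Delta> \<gamma>) prog (input_state d k \<Delta> m) t s \<and>
          real t \<le> C * (real d * (real \<gamma> + log 2 (real k)) * lg d * lg \<Delta>) \<and>
          xhat = decode e (output_array s) \<and>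
          ((\<exists>z. is_arg_min (l2_dist d x) (\<lambda>x'. supp d x' \<in> sep_sets_card d k \<Delta>) z) \<longrightarrow>
             is_arg_min (l2_dist d x) (\<lambda>x'. supp d x' \<in> sep_sets_card d k \<Delta>) xhat) \<and>
          ((\<exists>z. is_arg_min (l2_dist d x) (\<lambda>x'. \<exists>\<Omega>\<in>sep_sets_card d k \<Delta>. supp d x' \<subseteq> \<Omega>) z) \<longrightarrow>
             is_arg_min (l2_dist d x) (\<lambda>x'. \<exists>\<Omega>\<in>sep_sets_card d k \<Delta>. supp d x' \<subseteq> \<Omega>) xhat))"
proof (rule exI[of _ main_com], rule exI[of _ 10], rule exI[of _ 2200], intro allI impI, elim conjE)
  fix d k \<Delta> \<gamma> :: nat and x :: "nat \<Rightarrow> real" and m :: "nat \<Rightarrow> int" and e :: int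
  assume d: "1 \<le> d" and k: "1 \<le> k" and \<Delta>: "1 \<le> \<Delta>" and x: "\<forall>i\<in>{1..d}. x i = decode e m i"
    and \<gamma>: "\<gamma> = max_bits d m"
  define M :: int where "M = 2 ^ (bits (int k) + 2 * \<gamma>)"
  note bounds = problem_weight[OF d k \<Delta> \<gamma>, folded M_def]
  interpret problem "word_size 10 d k \<Delta> \<gamma>" d k \<Delta> "weight k m" "2 ^ word_size 10 d k \<Delta> \<gamma>" M
      "2 * (M * int k) + 2 * M + 3" by (rule bounds)
  let ?s = "input_state d k \<Delta> m"
  have "runs (word_size 10 d k \<Delta> \<gamma>) main_com ?s ((2 * bits (int k) + 2 * \<gamma> + 4) * (220 * d))
      (\<lambda>s'. (\<exists>zs. chain \<Delta> d zs \<and> length zs = k) \<longrightarrow> solves m s')"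
    by (rule main_runs[OF _ _ _ _ refl _ _ bounds(2)]) (auto simp: input_state_def weight_def)
  then obtain t s where t: "exec (word_size 10 d k \<Delta> \<gamma>) main_com ?s t s"
      "t \<le> (2 * bits (int k) + 2 * \<gamma> + 4) * (220 * d)"
    and s: "(\<exists>zs. chain \<Delta> d zs \<and> length zs = k) \<longrightarrow> solves m s" by (auto simp: runs_def)
  let ?A = "\<lambda>z. is_arg_min (l2_dist d x) (\<lambda>x'. supp d x' \<in> sep_sets_card d k \<Delta>) z"
  let ?B = "\<lambda>z. is_arg_min (l2_dist d x) (\<lambda>x'. \<exists>\<Omega>\<in>sep_sets_card d k \<Delta>. supp d x' \<subseteq> \<Omega>) z"
  have "((\<exists>z. ?A z) \<longrightarrow> ?A (decode e (output_array s))) \<and> ((\<exists>z. ?B z) \<longrightarrow> ?B (decode e (output_array s)))"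
  proof (cases "sep_sets_card d k \<Delta> = {}")
    case True
    \<comment> \<open>Without a separated \<open>k\<close>-set no vector is admissible, so both
      claims are vacuous.\<close>
    then show ?thesis by (simp add: is_arg_min_def)
  next
    case False
    then have "\<exists>zs. chain \<Delta> d zs \<and> length zs = k" using sep_sets_card_iff_chain[OF \<Delta>] by blast
    with s obtain us where us: "chain \<Delta> d us" "length us = k"
      and max: "\<And>zs. chain \<Delta> d zs \<Longrightarrow> length zs = k \<Longrightarrow>
        (\<Sum>z\<leftarrow>zs. weight k m z) \<le> (\<Sum>u\<leftarrow>us. weight k m u)"
      and out: "arrs s ''xhat'' = (\<lambda>p. if p \<in> set us then m p else 0)"
      by (auto simp: solves_def)
    \<comment> \<open>Chains have distinct entries, so maximality among lists transfers to
      maximality among sets.\<close>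
    have sum: "(\<Sum>z\<leftarrow>zs. weight k m z) = (\<Sum>z\<in>set zs. weight k m z)" if "chain \<Delta> d zs" for zs
      by (rule sum_list_distinct_conv_sum_set[OF chain_distinct[OF that \<Delta>]])
    have F: "set us \<in> sep_sets_card d k \<Delta>" using us sep_sets_card_iff_chain[OF \<Delta>] by blast
    have "(\<Sum>i\<in>\<Omega>'. weight k m i) \<le> (\<Sum>i\<in>set us. weight k m i)" if "\<Omega>' \<in> sep_sets_card d k \<Delta>" for \<Omega>'
      using that max sum us(1) unfolding sep_sets_card_iff_chain[OF \<Delta>] by metis
    from argmin_of_max_weight[OF x F this] show ?thesis
      unfolding output_array_def out by blast
  qed
  with t time_bound[OF k bounds(3) t(2), of \<Delta>] show "\<exists>t s xhat.
      exec (word_size 10 d k \<Delta> \<gamma>) main_com (input_state d k \<Delta> m) t s \<and>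
      real t \<le> 2200 * (real d * (real \<gamma> + log 2 (real k)) * lg d * lg \<Delta>) \<and>
      xhat = decode e (output_array s) \<and>
      ((\<exists>z. ?A z) \<longrightarrow> ?A xhat) \<and> ((\<exists>z. ?B z) \<longrightarrow> ?B xhat)"
    by blast
qed

end
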